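(* Let $q$ be a prime power and $n\ge2$ with $\gcd(q,n)=1$, and use the notation of the context. Let $I\subset\mathbb{F}_qD_n$ be a dihedral code and write $$\mathcal{P}(I)=\bigoplus_{j=1}^{r+s}B_j,\qquad B_j=\begin{cases}A_j,&j\in J_1\\ I_j(0,1),&j\in J_2\\ I_j(1,0),&j\in J_3\\ I_j(-x_j,1),&j\in J_4\\ 0,&j\notin J_1\cup J_2\cup J_3\cup J_4,\end{cases}$$ where $0\ne x_j\in F_j$ and $J_1,J_2,J_3\subset\{1,\dots,r+s\}$, $J_4\subset\{\zeta(n)+1,\dots,r+s\}$ are pairwise disjoint, with $1\notin J_2$ if $q$ is even. Then 1) the set $T=\bigcup_{j=1}^{r+s}\mathcal{B}(B_j)$ is an $\mathbb{F}_q$-basis of $I$; 2) the block matrix $\mathbf{G}_I$ obtained by stacking vertically the matrices $\mathbf{G}_{\overline{B_j}}$, $j\in J_1\cup J_2\cup J_3\cup J_4$, is a generating matrix of $I$.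
   Context: $D_n=\langle a,b\mid a^n=1,\ b^2=1,\ bab=a^{-1}\rangle$ is the dihedral group of order $2n$, $\mathbb{F}_qD_n$ its group algebra; every element is uniquely $P(a)+bQ(a)$ with $P,Q\in\mathbb{F}_q[x]$ of degree less than $n$. A dihedral code is a left ideal of $\mathbb{F}_qD_n$. For $g\in\mathbb{F}_q[x]$ with $g(0)\neq0$ put $g^*(x)=x^{\deg g}g(x^{-1})$. Factor $x^n-1$ over $\mathbb{F}_q$ into (pairwise distinct) monic irreducible factors as $x^n-1=(f_1f_2\cdots f_r)(f_{r+1}f_{r+1}^*\cdots f_{r+s}f_{r+s}^* )$, where $f_1=x-1$, $f_2=x+1$ if $n$ is even, $f_j^*=f_j$ for $1<j\le r$, and for $j>r$ the polynomials $f_j$ and $f_j^*$ have different roots (here the factor $f_j^*$, $j>r$, is normalized by a scalar to be monic). Let $\alpha_j$ be a root of $f_j$. Let $\zeta(n)=1$ if $n$ is odd, $\zeta(n)=2$ if $n$ is even. $\langle h\mid h^2\rangle$ is the cyclic group of order 2 generated by $h$. Put $F_j=\mathbb{F}_q$ for $1\le j\le\zeta(n)$, $F_j=\mathbb{F}_q[\alpha_j+\alpha_j^{-1}]$ for $\zeta(n)+1\le j\le r$, $F_j=\mathbb{F}_q[\alpha_j]$ for $r+1\le j\le r+s$. Put $A_j=\mathbb{F}_q\langle h\mid h^2\rangle$ for $1\le j\le\zeta(n)$ and $A_j=\mathrm{M}_2(F_j)$ for $\zeta(n)+1\le j\le r+s$. Define for $u=P(a)+bQ(a)$: $\gamma_1(u)=P(1)+Q(1)h$;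 $\gamma_2(u)=P(-1)+Q(-1)h$ (for $n$ even); for $j\ge\zeta(n)+1$, $\tau_j(u)=\begin{pmatrix}P(\alpha_j)&Q(\alpha_j^{-1})\\ Q(\alpha_j)&P(\alpha_j^{-1})\end{pmatrix}$; for $\zeta(n)+1\le j\le r$, $\sigma_j(X)=Z_j^{-1}XZ_j$ with $Z_j=\begin{pmatrix}1&-\alpha_j\\ 1&-\alpha_j^{-1}\end{pmatrix}$. Put $\mathcal{P}_j=\gamma_j$ for $j\le\zeta(n)$, $\mathcal{P}_j=\sigma_j\tau_j$ for $\zeta(n)+1\le j\le r$, $\mathcal{P}_j=\tau_j$ for $r+1\le j\le r+s$. It is known that $\mathcal{P}=\bigoplus_{j=1}^{r+s}\mathcal{P}_j:\mathbb{F}_qD_n\to\bigoplus_{j=1}^{r+s}A_j$ is an algebra isomorphism. For $x,y\in F_j$ put $I_j(x,y)=\mathbb{F}_q\langle h\mid h^2\rangle\left[(x+y)+(x-y)h\right]$ for $1\le j\le\zeta(n)$, and $I_j(x,y)=\left\{\begin{pmatrix}ky & -kx \\ ty & -tx\end{pmatrix}\mid k,t\in F_j\right\}$ for $\zeta(n)+1\le j\le r+s$. Every dihedral code has an image of the form written in the claim. For $S\subset A_j$ put $\overline{S}=\mathcal{P}^{-1}(0\oplus\dots\oplus S\oplus\dots\oplus0)$ ($S$ in position $j$). For a monic divisor $g$ of $x^n-1$ put $e_g(x)=-\frac{x^{\deg g-1}\,(g^* )'(x^{-1})}{n}\cdot\frac{x^n-1}{g(x)}$ (with $g^*(x)=x^{\deg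 g}g(x^{-1})$ unnormalized); it takes the value 1 at the roots of $g$ and 0 at the other roots of $x^n-1$. For $\zeta(n)+1\le j\le r$ let $F_{j,1},F_{j,2},G_{j,1},G_{j,2}\in\mathbb{F}_q[x]$ satisfy $(x-1)F_{j,1}+f_jF_{j,2}=1$ and $(x+1)G_{j,1}+f_jG_{j,2}=1$. The sets $\mathcal{B}(B_j)\subset\mathbb{F}_qD_n$ are: $\mathcal{B}(0)=\varnothing$; for $1\le j\le\zeta(n)$: $\mathcal{B}(A_j)=\{e_{f_j}(a),be_{f_j}(a)\}$, $\mathcal{B}(I_j(1,0))=\{e_{f_j}(a)+be_{f_j}(a)\}$, $\mathcal{B}(I_j(0,1))=\{e_{f_j}(a)-be_{f_j}(a)\}$; for $\zeta(n)+1\le j\le r$: $\mathcal{B}(A_j)=\{a^ib^ke_{f_j}(a)\mid 0\le i\le\deg f_j-1,\ k=0,1\}$, and for $u,v\in\mathbb{F}_q[x]$ with $(u(\alpha_j+\alpha_j^{-1}),v(\alpha_j+\alpha_j^{-1}))\ne(0,0)$, $\mathcal{B}(I_j(u(\alpha_j+\alpha_j^{-1}),v(\alpha_j+\alpha_j^{-1})))=\{a^i(1+b)F_{j,1}(a)G_{j,1}(a)(au(a+a^{-1})-v(a+a^{-1}))e_{f_j}(a)\mid 0\le i\le\deg f_j-1\}$ (applied to $I_j(0,1)$, $I_j(1,0)$, $I_j(-x_j,1)$ by choosing $u,v$ with the corresponding values); for $r+1\le j\le r+s$: $\mathcal{B}(A_j)=\{a^ib^ke_{f_j}(a),\ a^ib^ke_{f_j^*}(a)\mid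 0\le i\le\deg f_j-1,\ k=0,1\}$, and for $u,v\in\mathbb{F}_q[x]$ with $(v(\alpha_j^{-1}),u(\alpha_j))\neq(0,0)$, $\mathcal{B}(I_j(-v(\alpha_j^{-1}),u(\alpha_j)))=\{a^ib^k(u(a)e_{f_j}(a)+bv(a)e_{f_j^*}(a))\mid 0\le i\le\deg f_j-1,\ k=0,1\}$ (applied to $I_j(0,1)$ with $u=1,v=0$; to $I_j(1,0)=I_j(-1,0)$ with $u=0,v=1$; to $I_j(-x_j,1)$ with $u=1$, $v(\alpha_j^{-1})=x_j$). Let $\phi:\mathbb{F}_qD_n\to\mathbb{F}_q^{2n}$ be the linear isomorphism with $\phi(a^i)=\mathbf{e}_{i+1}$, $\phi(ba^i)=\mathbf{e}_{n+i+1}$ ($0\le i\le n-1$), $\mathbf e_k$ the standard basis. A generating matrix of a code $I$ is a matrix whose rows are $\phi(s_1),\dots,\phi(s_k)$ for a basis $s_1,\dots,s_k$ of $I$. $\mathbf{G}_{\overline{B_j}}$ is the matrix whose rows are the vectors $\phi(s)$, $s\in\mathcal{B}(B_j)$. *)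

theory Defs
  imports
    "HOL-Library.Poly_Mapping"
    "HOL-Library.Z2"
    "HOL-Library.FuncSet"
    "HOL-Algebra.Algebraic_Closure_Type"
    "Berlekamp_Zassenhaus.Finite_Field"
    "Jordan_Normal_Form.Gauss_Jordan_Elimination"
begin

section \<open>The dihedral group and its group algebra\<close>

text \<open>
  \<open>Dih k i\<close> stands for \<open>b\<^sup>k a\<^sup>i\<close> in the dihedral group of order \<open>2n\<close>, where \<open>n = CARD('n)\<close>
  and the exponents live in the integers modulo 2 and modulo \<open>n\<close>.  The group law is written
  additively (although it is not commutative), because the product of
  \<^typ>\<open>'g \<Rightarrow>\<^sub>0 'a\<close> is the convolution with respect to an additively written monoid of keys:
  with this instance, \<open>'n dihedral \<Rightarrow>\<^sub>0 'a\<close> is the group algebra over \<open>'a\<close>.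
\<close>

datatype 'n dihedral = Dih bit "'n mod_ring"

instantiation dihedral :: (nontriv) group_add
begin

definition zero_dihedral :: "'n::nontriv dihedral" where
  "zero_dihedral = Dih 0 0"

text \<open>\<open>b\<^sup>k a\<^sup>i b\<^sup>l a\<^sup>j = b\<^bsup>k+l\<^esup> a\<^bsup>\<plusminus>i+j\<^esup>\<close>, with the sign \<open>-\<close> exactly if \<open>l = 1\<close>.\<close>

fun plus_dihedral :: "'n::nontriv dihedral \<Rightarrow> 'n dihedral \<Rightarrow> 'n dihedral" where
  "plus_dihedral (Dih k i) (Dih l j) = Dih (k + l) ((if l = 0 then i else - i) + j)"

fun uminus_dihedral :: "'n::nontriv dihedral \<Rightarrow> 'n dihedral" where
  "uminus_dihedral (Dih k i) = Dih k (if k = 0 then - i else i)"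

definition minus_dihedral :: "'n::nontriv dihedral \<Rightarrow> 'n dihedral \<Rightarrow> 'n dihedral" where
  "minus_dihedral x y = x + (- y)"

instance
proof
  fix x y z :: "'a::nontriv dihedral"
  show "x + y + z = x + (y + z)"
    by (cases x; cases y; cases z) (auto simp: add.assoc)
  show "0 + x = x" "x + 0 = x" "- x + x = 0"
    by (cases x; auto simp: zero_dihedral_def)+
  show "x + - y = x - y"
    by (simp add: minus_dihedral_def)
qed

end

type_synonym ('n, 'a) dihedral_algebra = "'n dihedral \<Rightarrow>\<^sub>0 'a"

definition gen_a :: "('n::nontriv, 'a::comm_ring_1) dihedral_algebra" where
  "gen_a = Poly_Mapping.single (Dih 0 1) 1"

definition gen_a_inv :: "('n::nontriv, 'a::comm_ring_1) dihedral_algebra" where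
  "gen_a_inv = Poly_Mapping.single (- Dih 0 1) 1"

definition gen_b :: "('n::nontriv, 'a::comm_ring_1) dihedral_algebra" where
  "gen_b = Poly_Mapping.single (Dih 1 0) 1"

definition scale :: "'a \<Rightarrow> ('n::nontriv, 'a::comm_ring_1) dihedral_algebra \<Rightarrow> ('n, 'a) dihedral_algebra" where
  "scale c u = Poly_Mapping.single 0 c * u"

definition eval_at :: "'a poly \<Rightarrow> ('n::nontriv, 'a::comm_ring_1) dihedral_algebra \<Rightarrow> ('n, 'a) dihedral_algebra" where
  "eval_at p w = (\<Sum>i\<le>degree p. scale (Polynomial.coeff p i) (w ^ i))"

text \<open>The polynomials \<open>P\<close> and \<open>Q\<close> of degree less than \<open>n\<close> with \<open>u = P(a) + b Q(a)\<close>.\<close>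

definition P_part :: "('n::nontriv, 'a::comm_ring_1) dihedral_algebra \<Rightarrow> 'a poly" where
  "P_part u = (\<Sum>i<CARD('n). Polynomial.monom (Poly_Mapping.lookup u (Dih 0 (of_nat i))) i)"

definition Q_part :: "('n::nontriv, 'a::comm_ring_1) dihedral_algebra \<Rightarrow> 'a poly" where
  "Q_part u = (\<Sum>i<CARD('n). Polynomial.monom (Poly_Mapping.lookup u (Dih 1 (of_nat i))) i)"

definition left_ideal :: "'r::ring_1 set \<Rightarrow> bool" where
  "left_ideal I \<longleftrightarrow> 0 \<in> I \<and> (\<forall>x\<in>I. \<forall>y\<in>I. x + y \<in> I) \<and> (\<forall>w. \<forall>x\<in>I. w * x \<in> I)"

definition is_basis :: "('n::nontriv, 'a::field) dihedral_algebra set \<Rightarrow> ('n, 'a) dihedral_algebra set \<Rightarrow> bool" where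
  "is_basis T I \<longleftrightarrow> \<not> module.dependent scale T \<and> module.span scale T = I"

subsection \<open>Agreement with the presentation\<close>

lemma gen_a_power: "(gen_a :: ('n::nontriv, 'a::comm_ring_1) dihedral_algebra) ^ i = Poly_Mapping.single (Dih 0 (of_nat i)) 1"
  by (induction i) (simp_all add: gen_a_def zero_dihedral_def mult_single flip: single_one)

lemma gen_b_gen_a_power:
  "gen_b * (gen_a :: ('n::nontriv, 'a::comm_ring_1) dihedral_algebra) ^ i = Poly_Mapping.single (Dih 1 (of_nat i)) 1"
  by (simp add: gen_a_power gen_b_def mult_single)

lemma dihedral_relations:
  "(gen_a :: ('n::nontriv, 'a::comm_ring_1) dihedral_algebra) ^ CARD('n) = 1"
  "(gen_b :: ('n, 'a) dihedral_algebra) ^ 2 = 1"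
  "gen_b * gen_a * gen_b = (gen_a_inv :: ('n, 'a) dihedral_algebra)"
  "gen_a * gen_a_inv = (1 :: ('n, 'a) dihedral_algebra)"
proof -
  show "(gen_a :: ('n::nontriv, 'a::comm_ring_1) dihedral_algebra) ^ CARD('n) = 1"
    unfolding gen_a_power by (simp add: zero_dihedral_def flip: single_one)
qed (simp_all add: power2_eq_square gen_a_inv_def gen_a_def gen_b_def mult_single
      zero_dihedral_def flip: single_one)

lemma UNIV_dihedral: "(UNIV :: 'n::nontriv dihedral set) = (\<lambda>(k, i). Dih k i) ` (UNIV \<times> UNIV)"
  by (auto simp: image_iff) (metis dihedral.exhaust)

lemma UNIV_bit: "(UNIV :: bit set) = {0, 1}"
  by (auto intro: bit.exhaust)

lemma CARD_dihedral: "CARD('n::nontriv dihedral) = 2 * CARD('n)"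
  unfolding UNIV_dihedral
  by (subst card_image) (auto simp: inj_on_def card_cartesian_product UNIV_bit simp flip: UNIV_Times_UNIV)

lemma lookup_scale: "Poly_Mapping.lookup (scale c u) g = c * Poly_Mapping.lookup u g"
proof -
  have "scale c u = Poly_Mapping.map ((*) c) u"
    by (simp add: scale_def mult_map_scale_conv_mult)
  then show ?thesis
    by (simp add: map.rep_eq when_def)
qed

interpretation dihedral_algebra: vector_space "scale :: 'a::field \<Rightarrow> ('n::nontriv, 'a) dihedral_algebra \<Rightarrow> _"
  by unfold_locales (rule poly_mapping_eqI, simp add: lookup_scale lookup_add algebra_simps)+

section \<open>Polynomials attached to the factorization\<close>

text \<open>\<^const>\<open>reflect_poly\<close> \<open>g\<close> is \<open>g\<^sup>*(x) = x\<^bsup>deg g\<^esup> g(1/x)\<close>; the following is its monic associate.\<close>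

definition monic_recip :: "'a::field poly \<Rightarrow> 'a poly" where
  "monic_recip g = Polynomial.smult (inverse (lead_coeff (reflect_poly g))) (reflect_poly g)"

text \<open>
  \<open>e\<^sub>g(x) = - x\<^bsup>deg g - 1\<^esup> (g\<^sup>*)'(1/x) / n \<cdot> (x\<^sup>n - 1) / g(x)\<close>.  The factor
  \<open>x\<^bsup>deg g - 1\<^esup> (g\<^sup>*)'(1/x)\<close> is a polynomial since \<open>(g\<^sup>*)'\<close> has degree at most \<open>deg g - 1\<close>;
  it can be strictly smaller, so \<^const>\<open>reflect_poly\<close> \<open>(g\<^sup>*)'\<close> would be wrong here.
\<close>

definition e_poly :: "nat \<Rightarrow> 'a::field poly \<Rightarrow> 'a poly" where
  "e_poly n g =
     Polynomial.smult (- inverse (of_nat n))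
       ((\<Sum>i<degree g. Polynomial.monom (Polynomial.coeff (pderiv (reflect_poly g)) i) (degree g - 1 - i))
        * ((Polynomial.monom 1 n - 1) div g))"

section \<open>The components of the decomposition\<close>

definition zeta :: "nat \<Rightarrow> nat" where
  "zeta n = (if even n then 2 else 1)"

definition ac_eval :: "'a::field poly \<Rightarrow> 'a alg_closure \<Rightarrow> 'a alg_closure" where
  "ac_eval p z = poly (map_poly to_ac p) z"

definition adjoin :: "'a::field alg_closure \<Rightarrow> 'a alg_closure set" where
  "adjoin z = {ac_eval p z | p. True}"

text \<open>All fields \<open>F\<^sub>j\<close> are subfields of the algebraic closure; the ground field is \<^term>\<open>range to_ac\<close>.\<close>

definition comp_field :: "nat \<Rightarrow> nat \<Rightarrow> (nat \<Rightarrow> 'a::field alg_closure) \<Rightarrow> nat \<Rightarrow> 'a alg_closure set" where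
  "comp_field n r \<alpha> j =
     (if j \<le> zeta n then range to_ac
      else if j \<le> r then adjoin (\<alpha> j + inverse (\<alpha> j))
      else adjoin (\<alpha> j))"

text \<open>
  The algebras \<open>A\<^sub>j\<close> are of two shapes: \<open>Inl\<close> is used for the group algebra of the cyclic group
  \<open>\<langle>h | h\<^sup>2\<rangle>\<close>, whose elements \<open>1, h\<close> are the keys \<open>0, 1 :: bit\<close>, and \<open>Inr\<close> for 2 by 2 matrices.
\<close>

type_synonym 'a component = "(bit \<Rightarrow>\<^sub>0 'a alg_closure) + 'a alg_closure mat"

definition cyc_algebra :: "(bit \<Rightarrow>\<^sub>0 'a::field alg_closure) set" where
  "cyc_algebra = {w. \<forall>k. Poly_Mapping.lookup w k \<in> range to_ac}"

definition cyc_elem :: "'a::field alg_closure \<Rightarrow> 'a alg_closure \<Rightarrow> bit \<Rightarrow>\<^sub>0 'a alg_closure" where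
  "cyc_elem c d = Poly_Mapping.single 0 c + Poly_Mapping.single 1 d"

definition mat22 :: "'b \<Rightarrow> 'b \<Rightarrow> 'b \<Rightarrow> 'b \<Rightarrow> 'b mat" where
  "mat22 c d c' d' = mat_of_rows_list 2 [[c, d], [c', d']]"

definition comp_algebra :: "nat \<Rightarrow> nat \<Rightarrow> (nat \<Rightarrow> 'a::field alg_closure) \<Rightarrow> nat \<Rightarrow> 'a component set" where
  "comp_algebra n r \<alpha> j =
     (if j \<le> zeta n then Inl ` cyc_algebra
      else Inr ` {Y \<in> carrier_mat 2 2. elements_mat Y \<subseteq> comp_field n r \<alpha> j})"

definition comp_zero :: "nat \<Rightarrow> nat \<Rightarrow> 'a::field component set" where
  "comp_zero n j = (if j \<le> zeta n then {Inl 0} else {Inr (0\<^sub>m 2 2)})"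

definition comp_ideal ::
  "nat \<Rightarrow> nat \<Rightarrow> (nat \<Rightarrow> 'a::field alg_closure) \<Rightarrow> nat \<Rightarrow> 'a alg_closure \<Rightarrow> 'a alg_closure \<Rightarrow> 'a component set" where
  "comp_ideal n r \<alpha> j x y =
     (if j \<le> zeta n then Inl ` {w * cyc_elem (x + y) (x - y) | w. w \<in> cyc_algebra}
      else Inr ` {mat22 (k * y) (- k * x) (t * y) (- t * x) | k t.
                    k \<in> comp_field n r \<alpha> j \<and> t \<in> comp_field n r \<alpha> j})"

text \<open>\<open>cyc_map 1\<close> and \<open>cyc_map (- 1)\<close> are \<open>\<gamma>\<^sub>1\<close> and \<open>\<gamma>\<^sub>2\<close>.\<close>

definition cyc_map :: "'a::field \<Rightarrow> ('n::nontriv, 'a) dihedral_algebra \<Rightarrow> bit \<Rightarrow>\<^sub>0 'a alg_closure" where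
  "cyc_map c u = cyc_elem (to_ac (poly (P_part u) c)) (to_ac (poly (Q_part u) c))"

definition tau :: "'a::field alg_closure \<Rightarrow> ('n::nontriv, 'a) dihedral_algebra \<Rightarrow> 'a alg_closure mat" where
  "tau z u = mat22 (ac_eval (P_part u) z) (ac_eval (Q_part u) (inverse z))
                   (ac_eval (Q_part u) z) (ac_eval (P_part u) (inverse z))"

definition sigma :: "'a::field alg_closure \<Rightarrow> 'a alg_closure mat \<Rightarrow> 'a alg_closure mat" where
  "sigma z Y = (let Z = mat22 1 (- z) 1 (- inverse z) in the (mat_inverse Z) * Y * Z)"

definition comp_map ::
  "nat \<Rightarrow> (nat \<Rightarrow> 'a::field alg_closure) \<Rightarrow> nat \<Rightarrow> ('n::nontriv, 'a) dihedral_algebra \<Rightarrow> 'a component" where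
  "comp_map r \<alpha> j u =
     (if j = 1 then Inl (cyc_map 1 u)
      else if j \<le> zeta CARD('n) then Inl (cyc_map (- 1) u)
      else if j \<le> r then Inr (sigma (\<alpha> j) (tau (\<alpha> j) u))
      else Inr (tau (\<alpha> j) u))"

definition full_map ::
  "nat \<Rightarrow> nat \<Rightarrow> (nat \<Rightarrow> 'a::field alg_closure) \<Rightarrow> ('n::nontriv, 'a) dihedral_algebra \<Rightarrow> nat \<Rightarrow> 'a component" where
  "full_map r s \<alpha> u = (\<lambda>j\<in>{1..r+s}. comp_map r \<alpha> j u)"

section \<open>The sets \<open>\<B>(B\<^sub>j)\<close>\<close>

definition e_elem :: "'a::field poly \<Rightarrow> ('n::nontriv, 'a) dihedral_algebra" where
  "e_elem g = eval_at (e_poly CARD('n) g) gen_a"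

definition full_set_cyc :: "'a::field poly \<Rightarrow> ('n::nontriv, 'a) dihedral_algebra set" where
  "full_set_cyc g = {e_elem g, gen_b * e_elem g}"

definition full_set_self :: "'a::field poly \<Rightarrow> ('n::nontriv, 'a) dihedral_algebra set" where
  "full_set_self g = {gen_a ^ i * gen_b ^ k * e_elem g | i k. i < degree g \<and> k < 2}"

definition full_set_pair :: "'a::field poly \<Rightarrow> ('n::nontriv, 'a) dihedral_algebra set" where
  "full_set_pair g = full_set_self g \<union>
     {gen_a ^ i * gen_b ^ k * e_elem (monic_recip g) | i k. i < degree g \<and> k < 2}"

text \<open>
  \<open>F\<close> and \<open>G\<close> are the Bezout coefficients \<open>F\<^sub>j\<^sub>,\<^sub>1\<close> and \<open>G\<^sub>j\<^sub>,\<^sub>1\<close>; this is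
  \<open>\<B>(I\<^sub>j(u(\<alpha> + 1/\<alpha>), v(\<alpha> + 1/\<alpha>)))\<close>.
\<close>

definition ideal_set_self ::
  "'a::field poly \<Rightarrow> 'a poly \<Rightarrow> 'a poly \<Rightarrow> 'a poly \<Rightarrow> 'a poly \<Rightarrow> ('n::nontriv, 'a) dihedral_algebra set" where
  "ideal_set_self g F G u v =
     {gen_a ^ i * (1 + gen_b) * eval_at F gen_a * eval_at G gen_a
        * (gen_a * eval_at u (gen_a + gen_a_inv) - eval_at v (gen_a + gen_a_inv)) * e_elem g
      | i. i < degree g}"

text \<open>This is \<open>\<B>(I\<^sub>j(- v(1/\<alpha>), u(\<alpha>)))\<close>.\<close>

definition ideal_set_pair ::
  "'a::field poly \<Rightarrow> 'a poly \<Rightarrow> 'a poly \<Rightarrow> ('n::nontriv, 'a) dihedral_algebra set" where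
  "ideal_set_pair g u v =
     {gen_a ^ i * gen_b ^ k
        * (eval_at u gen_a * e_elem g + gen_b * eval_at v gen_a * e_elem (monic_recip g))
      | i k. i < degree g \<and> k < 2}"

definition basis_set ::
  "nat \<Rightarrow> (nat \<Rightarrow> 'a::field poly) \<Rightarrow> (nat \<Rightarrow> 'a poly) \<Rightarrow> (nat \<Rightarrow> 'a poly)
    \<Rightarrow> nat set \<Rightarrow> nat set \<Rightarrow> nat set \<Rightarrow> nat set \<Rightarrow> (nat \<Rightarrow> 'a poly) \<Rightarrow> (nat \<Rightarrow> 'a poly)
    \<Rightarrow> nat \<Rightarrow> ('n::nontriv, 'a) dihedral_algebra set" where
  "basis_set r f F G J1 J2 J3 J4 u v j =
     (if j \<in> J1 then
        (if j \<le> zeta CARD('n) then full_set_cyc (f j)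
         else if j \<le> r then full_set_self (f j)
         else full_set_pair (f j))
      else if j \<in> J2 \<union> J3 \<union> J4 then
        (if j \<le> zeta CARD('n) then
           (if j \<in> J3 then {e_elem (f j) + gen_b * e_elem (f j)}
            else {e_elem (f j) - gen_b * e_elem (f j)})
         else if j \<le> r then ideal_set_self (f j) (F j) (G j) (u j) (v j)
         else ideal_set_pair (f j) (u j) (v j))
      else {})"

section \<open>Generating matrices\<close>

text \<open>Coordinates are numbered from 0: \<open>a\<^sup>i\<close> is sent to unit vector \<open>i\<close>, and \<open>b a\<^sup>i\<close> to unit vector \<open>n + i\<close>.\<close>

definition phi :: "('n::nontriv, 'a::comm_ring_1) dihedral_algebra \<Rightarrow> 'a vec" where
  "phi u = vec (2 * CARD('n)) (\<lambda>i.
     if i < CARD('n) then Poly_Mapping.lookup u (Dih 0 (of_nat i))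
     else Poly_Mapping.lookup u (Dih 1 (of_nat (i - CARD('n)))))"

definition rows_matrix :: "('n::nontriv, 'a::comm_ring_1) dihedral_algebra list \<Rightarrow> 'a mat" where
  "rows_matrix ss = mat_of_rows (2 * CARD('n)) (map phi ss)"

text \<open>The order of the rows is left open.\<close>

definition is_rows_matrix_of_set :: "'a mat \<Rightarrow> ('n::nontriv, 'a::comm_ring_1) dihedral_algebra set \<Rightarrow> bool" where
  "is_rows_matrix_of_set M S \<longleftrightarrow> (\<exists>ss. distinct ss \<and> set ss = S \<and> M = rows_matrix ss)"

definition is_generating_matrix :: "'a mat \<Rightarrow> ('n::nontriv, 'a::field) dihedral_algebra set \<Rightarrow> bool" where
  "is_generating_matrix M I \<longleftrightarrow> (\<exists>ss. distinct ss \<and> is_basis (set ss) I \<and> M = rows_matrix ss)"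

definition stack_rows :: "nat \<Rightarrow> 'a::zero mat list \<Rightarrow> 'a mat" where
  "stack_rows m Ms = foldr append_rows Ms (0\<^sub>m 0 m)"

subsection \<open>Agreement with the description of \<open>P\<close>, \<open>Q\<close> and \<open>\<phi>\<close>\<close>

lemma of_nat_mod_ring_eq_iff:
  assumes "i < CARD('n)" "j < CARD('n)"
  shows "(of_nat i :: 'n::nontriv mod_ring) = of_nat j \<longleftrightarrow> i = j"
  using assms by (metis of_nat_of_int_mod_ring comp_apply of_nat_0_le_iff of_nat_eq_iff of_nat_less_iff
      to_int_mod_ring_of_int_mod_ring)

lemma phi_gen:
  assumes "i < CARD('n)"
  shows "phi ((gen_a :: ('n::nontriv, 'a::comm_ring_1) dihedral_algebra) ^ i) = unit_vec (2 * CARD('n)) i"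
    and "phi (gen_b * (gen_a :: ('n, 'a) dihedral_algebra) ^ i) = unit_vec (2 * CARD('n)) (CARD('n) + i)"
  using assms
  by (auto simp: phi_def gen_a_power gen_b_def mult_single lookup_single when_def of_nat_mod_ring_eq_iff
      simp del: of_nat_diff intro!: eq_vecI)

lemma range_of_nat_mod_ring: "(UNIV :: 'n::nontriv mod_ring set) = of_nat ` {..<CARD('n)}"
proof -
  have "inj_on (of_nat :: nat \<Rightarrow> 'n mod_ring) {..<CARD('n)}"
    by (auto simp: inj_on_def of_nat_mod_ring_eq_iff)
  then have "card (of_nat ` {..<CARD('n)} :: 'n mod_ring set) = CARD('n mod_ring)"
    by (simp add: card_image)
  then show ?thesis
    by (metis card_subset_eq finite subset_UNIV)
qed

lemma degree_P_Q_part: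
  fixes w :: "('n::nontriv, 'a::comm_ring_1) dihedral_algebra"
  shows "degree (P_part w) < CARD('n)" "degree (Q_part w) < CARD('n)"
proof -
  have "degree (\<Sum>i<CARD('n). Polynomial.monom (g i :: 'a) i) < CARD('n)" for g
    by (rule degree_sum_less) (auto intro: le_less_trans[OF degree_monom_le])
  then show "degree (P_part w) < CARD('n)" "degree (Q_part w) < CARD('n)"
    by (simp_all add: P_part_def Q_part_def)
qed

lemma P_Q_part:
  fixes w :: "('n::nontriv, 'a::comm_ring_1) dihedral_algebra"
  shows "w = eval_at (P_part w) gen_a + gen_b * eval_at (Q_part w) gen_a"
proof (rule poly_mapping_eqI)
  fix g :: "'n dihedral"
  obtain k m where "g = Dih k m" by (cases g)
  moreover obtain i where i: "i < CARD('n)" "m = of_nat i"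
    using range_of_nat_mod_ring by (metis UNIV_I imageE lessThan_iff)
  ultimately have g: "g = Dih k (of_nat i)" by simp
  have ev: "eval_at p (gen_a :: ('n, 'a) dihedral_algebra)
      = (\<Sum>i<CARD('n). Poly_Mapping.single (Dih 0 (of_nat i)) (Polynomial.coeff p i))"
    if "degree p < CARD('n)" for p
    unfolding eval_at_def scale_def gen_a_power mult_single zero_dihedral_def
    by (rule sum.mono_neutral_cong_left) (use that in \<open>auto simp: coeff_eq_0\<close>)
  have co: "Polynomial.coeff (P_part w) j = Poly_Mapping.lookup w (Dih 0 (of_nat j))"
    "Polynomial.coeff (Q_part w) j = Poly_Mapping.lookup w (Dih 1 (of_nat j))" if "j < CARD('n)" for j
    using that by (simp_all add: P_part_def Q_part_def coeff_sum)
  have delta: "(\<Sum>x<CARD('n). if (of_nat x :: 'n mod_ring) = of_nat i then h x else 0) = (h i :: 'a)" for h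
    using i(1) by (subst sum.cong[OF refl, of _ _ "\<lambda>x. if x = i then h x else 0"])
      (auto simp: of_nat_mod_ring_eq_iff)
  show "Poly_Mapping.lookup w g
      = Poly_Mapping.lookup (eval_at (P_part w) gen_a + gen_b * eval_at (Q_part w) gen_a) g"
    using i by (cases k) (simp_all add: g ev degree_P_Q_part gen_b_def sum_distrib_left mult_single
        lookup_add lookup_sum lookup_single when_def delta co)
qed

end

theory Submission
  imports Defs "HOL-Number_Theory.Residues"
begin

text \<open>
  Let \<open>z\<close> be an \<open>n\<close>-th root of unity.  The relation \<open>p(a) b = b p(1/a)\<close> shows that the matrix with the
  entries \<open>P(z), Q(1/z), Q(z), P(1/z)\<close> depends multiplicatively on \<open>P(a) + b Q(a)\<close>
  (\<open>rot_at_mult\<close>).  The \<open>f\<^sub>j\<close> and \<open>f\<^sub>j\<^sup>*\<close> are distinct monic primes with product \<open>x\<^sup>n - 1\<close>, so an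
  element of the group algebra is determined by these four values at \<open>z = \<alpha>\<^sub>1, \<dots>, \<alpha>\<^bsub>r+s\<^esub>\<close>: if all of
  them vanish, then \<open>x\<^sup>n - 1\<close> divides \<open>P\<close> and \<open>Q\<close>, which have degree less than \<open>n\<close>.  In each component,
  the image of an element under the decomposition carries the same information as the four values.
  Consequently a code is the set of all elements that satisfy the condition \<open>B\<^sub>j\<close> at every \<open>j\<close>.

  Every generator contains a factor \<open>e\<^sub>g(a)\<close> with \<open>g = f\<^sub>j\<close> or \<open>g = f\<^sub>j\<^sup>*\<close>, and \<open>e\<^sub>g\<close> is \<open>1\<close> at the roots
  of \<open>g\<close> and \<open>0\<close> at all other \<open>n\<close>-th roots of unity (\<open>ac_eval_e_poly\<close>).  So the generators that belong to \<open>j\<close>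
  are invisible at the other indices, and both independence and spanning can be tested one index at
  a time (\<open>glued_basis\<close>).

  At a fixed index, let \<open>d = deg f\<^sub>j\<close> and \<open>\<alpha> = \<alpha>\<^sub>j\<close>.  The generators are \<open>a\<^sup>i x\<close> with \<open>i < d\<close> and \<open>x\<close> from a list of
  one, two or four elements.  Their linear combinations are the sums of terms \<open>p(a) x\<close> with
  \<open>deg p < d\<close>, and the values of \<open>p(a) x\<close> are those of \<open>x\<close> multiplied by \<open>p(\<alpha>)\<close> or \<open>p(1/\<alpha>)\<close>.  A
  polynomial of degree less than \<open>d\<close> is determined by its value at \<open>\<alpha>\<close>, and every element of
  \<open>\<F>\<^sub>q[\<alpha>]\<close> is such a value; the same is true at \<open>1/\<alpha>\<close>.  The first fact gives independence and the second
  one gives spanning (the lemmas \<open>local_basis_full_self\<close>, \<open>local_basis_full_pair\<close>, \<open>local_basis_cyc\<close>,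
  \<open>local_basis_pair\<close> and \<open>local_basis_self\<close>).

  Only the ideals in the components with \<open>\<zeta>(n) < j \<le> r\<close> need a computation.  There the values of the
  generator are \<open>W(\<alpha>)\<close> and \<open>W(1/\<alpha>)\<close> with \<open>W(y) = (y U - V) / (y\<^sup>2 - 1)\<close>; these are the solutions of
  \<open>W(\<alpha>) + W(1/\<alpha>) = V\<close>, \<open>\<alpha> W(\<alpha>) + W(1/\<alpha>)/\<alpha> = U\<close>, so that multiplication by \<open>Z\<^sub>j\<close> from the right turns the
  row \<open>(W(\<alpha>), W(1/\<alpha>))\<close> into the row \<open>(V, -U)\<close> of the ideal.  On the left, \<open>Z\<^sub>j\<close> sends a column \<open>(k, t)\<close>
  to \<open>(k - \<alpha> t, k - t/\<alpha>)\<close>, and the columns \<open>(p(\<alpha>), p(1/\<alpha>))\<close> are exactly those with \<open>k\<close> and \<open>t\<close> in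
  \<open>\<F>\<^sub>q[\<alpha> + 1/\<alpha>]\<close> (\<open>poly_split_over_symmetric_subfield\<close>).

  The generating matrix is the list of all generators, block by block: the blocks are disjoint,
  because the whole family of generators is independent.
\<close>

section \<open>Polynomials at points of the algebraic closure\<close>

lemma map_poly_to_ac_mult: "map_poly to_ac (p * q) = map_poly to_ac p * map_poly to_ac q"
  by (rule poly_eqI) (simp add: coeff_map_poly coeff_mult to_ac_sum)

lemma ac_eval_add [simp]: "ac_eval (p + q) z = ac_eval p z + ac_eval q z"
proof -
  have "map_poly to_ac (p + q) = map_poly to_ac p + map_poly to_ac q"
    by (rule poly_eqI) (simp add: coeff_map_poly)
  then show ?thesis by (simp add: ac_eval_def)
qed

lemma ac_eval_uminus [simp]: "ac_eval (- p) z = - ac_eval p z"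
proof -
  have "map_poly to_ac (- p) = - map_poly to_ac p"
    by (rule poly_eqI) (simp add: coeff_map_poly)
  then show ?thesis by (simp add: ac_eval_def)
qed

lemma ac_eval_diff [simp]: "ac_eval (p - q) z = ac_eval p z - ac_eval q z"
  using ac_eval_add[of p "- q" z] by simp

lemma ac_eval_mult [simp]: "ac_eval (p * q) z = ac_eval p z * ac_eval q z"
  by (simp add: ac_eval_def map_poly_to_ac_mult)

lemma ac_eval_0 [simp]: "ac_eval 0 z = 0"
  and ac_eval_1 [simp]: "ac_eval 1 z = 1"
  by (simp_all add: ac_eval_def)

lemma ac_eval_pCons [simp]: "ac_eval (pCons c p) z = to_ac c + z * ac_eval p z"
proof -
  have "map_poly to_ac (pCons c p) = pCons (to_ac c) (map_poly to_ac p)"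
    by (rule poly_eqI) (simp add: coeff_map_poly coeff_pCons split: nat.splits)
  then show ?thesis by (simp add: ac_eval_def)
qed

lemma ac_eval_smult [simp]: "ac_eval (Polynomial.smult c p) z = to_ac c * ac_eval p z"
  by (induction p) (simp_all add: algebra_simps)

lemma ac_eval_monom [simp]: "ac_eval (Polynomial.monom c i) z = to_ac c * z ^ i"
  by (induction i) (simp_all add: monom_0 monom_Suc algebra_simps)

lemma ac_eval_sum [simp]: "ac_eval (sum p A) z = (\<Sum>i\<in>A. ac_eval (p i) z)"
  by (induction A rule: infinite_finite_induct) simp_all

lemma ac_eval_pcompose [simp]: "ac_eval (pcompose p q) z = ac_eval p (ac_eval q z)"
  by (induction p) (simp_all add: pcompose_pCons)

lemma ac_eval_to_ac: "ac_eval p (to_ac c) = to_ac (poly p c)"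
  by (induction p) simp_all

lemma ac_eval_altdef: "ac_eval p z = (\<Sum>i\<le>degree p. to_ac (Polynomial.coeff p i) * z ^ i)"
  by (subst (1) poly_as_sum_of_monoms[of p, symmetric]) simp

text \<open>
  A nonzero polynomial of least degree with the root \<open>z\<close> divides every polynomial with that root, in
  particular \<open>g\<close>; as \<open>g\<close> is irreducible, the two are associated.
\<close>

lemma ac_eval_eq_0_iff_dvd:
  fixes g p :: "'a::field poly"
  assumes g: "irreducible g" "ac_eval g z = 0"
  shows "ac_eval p z = 0 \<longleftrightarrow> g dvd p"
proof
  show "ac_eval p z = 0" if "g dvd p"
    using that g(2) by (elim dvdE) simp
  have "g \<noteq> 0" using g(1) by auto
  then obtain m where m: "m \<noteq> 0" "ac_eval m z = 0"
    and least: "\<And>m'. m' \<noteq> 0 \<Longrightarrow> ac_eval m' z = 0 \<Longrightarrow> degree m \<le> degree m'"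
    using g(2) arg_min_nat_lemma[of "\<lambda>m. m \<noteq> 0 \<and> ac_eval m z = 0" g degree] by blast
  have dvd: "m dvd p" if p: "ac_eval p z = 0" for p
  proof -
    have "ac_eval p z = ac_eval (p div m * m + p mod m) z" by simp
    then have "ac_eval (p mod m) z = 0"
      unfolding ac_eval_add ac_eval_mult using m p by simp
    then have "p mod m = 0"
      using least[of "p mod m"] degree_mod_less[OF m(1), of p] by linarith
    then show ?thesis by auto
  qed
  have "\<not> m dvd 1"
  proof
    assume "m dvd 1"
    then obtain k where "1 = m * k" by (elim dvdE)
    then have "ac_eval (m * k) z = 1" by (metis ac_eval_1)
    then show False using m by simp
  qed
  then have "g dvd m"
    using dvd[OF g(2)] g(1) by (metis dvd_def irreducible_altdef)
  then show "g dvd p" if "ac_eval p z = 0"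
    using dvd[OF that] dvd_trans by blast
qed

lemma ac_eval_reflect_poly:
  assumes "z \<noteq> 0"
  shows "ac_eval (reflect_poly p) z = z ^ degree p * ac_eval p (inverse z)"
proof -
  have deg: "degree (map_poly to_ac p) = degree p"
    by (rule degree_map_poly) simp
  have "map_poly to_ac (reflect_poly p) = reflect_poly (map_poly to_ac p)"
    by (rule poly_eqI) (simp add: coeff_map_poly coeff_reflect_poly deg)
  then show ?thesis
    using assms by (simp add: ac_eval_def poly_reflect_poly_nz deg)
qed

text \<open>
  The roots of the reciprocal polynomial are the inverses of the nonzero roots.
\<close>

lemma ac_eval_monic_recip_eq_0_iff:
  assumes "z \<noteq> 0"
  shows "ac_eval (monic_recip g) z = 0 \<longleftrightarrow> ac_eval g (inverse z) = 0"
proof (cases "g = 0")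
  case False
  then have "lead_coeff (reflect_poly g) \<noteq> 0" by simp
  then show ?thesis using assms
    by (simp add: monic_recip_def ac_eval_reflect_poly del: leading_coeff_0_iff)
qed (simp add: monic_recip_def)

lemma ac_eval_in_adjoin: "ac_eval p z \<in> adjoin z"
  by (auto simp: adjoin_def)

lemma adjoin_add: "c \<in> adjoin z \<Longrightarrow> d \<in> adjoin z \<Longrightarrow> c + d \<in> adjoin z"
  and adjoin_diff: "c \<in> adjoin z \<Longrightarrow> d \<in> adjoin z \<Longrightarrow> c - d \<in> adjoin z"
  and adjoin_mult: "c \<in> adjoin z \<Longrightarrow> d \<in> adjoin z \<Longrightarrow> c * d \<in> adjoin z"
  unfolding adjoin_def by (auto simp flip: ac_eval_add ac_eval_diff ac_eval_mult)

lemma adjoin_base: "to_ac c \<in> adjoin z" and adjoin_gen: "z \<in> adjoin z"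
  using ac_eval_in_adjoin[of "[:c:]" z] ac_eval_in_adjoin[of "[:0, 1:]" z] by simp_all

lemma adjoin_uminus: "c \<in> adjoin z \<Longrightarrow> - c \<in> adjoin z"
  using adjoin_diff[of 0 z c] adjoin_base[of 0 z] by simp

text \<open>
  \<open>z\<close> and \<open>1/z\<close> are the roots of \<open>y\<^sup>2 - \<beta> y + 1\<close> with \<open>\<beta> = z + 1/z\<close>, so \<open>1\<close> and \<open>z\<close> span \<open>K[z]\<close> over
  \<open>K[\<beta>]\<close>, where \<open>K\<close> is the ground field, and the same pair \<open>k, t\<close> serves both roots.  In the induction step, a multiplication
  by \<open>z\<close> maps the pair \<open>(k, t)\<close> to \<open>(t, \<beta> t - k)\<close>.
\<close>

lemma poly_split_over_symmetric_subfield: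
  assumes "z \<noteq> 0"
  obtains k t where "k \<in> adjoin (z + inverse z)" "t \<in> adjoin (z + inverse z)"
    "ac_eval p z = k - z * t" "ac_eval p (inverse z) = k - inverse z * t"
proof -
  let ?F = "adjoin (z + inverse z)"
  have "\<exists>k\<in>?F. \<exists>t\<in>?F. ac_eval p z = k - z * t \<and> ac_eval p (inverse z) = k - inverse z * t"
  proof (induction p)
    case 0
    have "0 \<in> ?F" using adjoin_base[of 0] by simp
    then show ?case by (intro bexI[of _ 0]) auto
  next
    case (pCons c p)
    then obtain k t where kt: "k \<in> ?F" "t \<in> ?F"
      and p: "ac_eval p z = k - z * t" "ac_eval p (inverse z) = k - inverse z * t"
      by blast
    have cancel: "z * (inverse z * y) = y" "inverse z * (z * y) = y" for y
      using assms by (simp_all flip: mult.assoc)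
    show ?case
    proof (rule bexI[of _ "to_ac c + t"], rule bexI[of _ "(z + inverse z) * t - k"], intro conjI)
      show "ac_eval (pCons c p) z = to_ac c + t - z * ((z + inverse z) * t - k)"
        using assms by (simp add: p algebra_simps cancel)
      show "ac_eval (pCons c p) (inverse z) = to_ac c + t - inverse z * ((z + inverse z) * t - k)"
        using assms by (simp add: p algebra_simps cancel)
    qed (use kt in \<open>auto intro!: adjoin_add adjoin_diff adjoin_mult adjoin_base adjoin_gen\<close>)
  qed
  then show ?thesis using that by blast
qed

text \<open>
  Divisibility by \<open>h\<close> is the kernel of an evaluation into a field, hence a prime ideal.
\<close>

lemma prime_elem_of_root:
  assumes "h \<noteq> 0" and "\<And>p. h dvd p \<longleftrightarrow> ac_eval p y = 0"
  shows "prime_elem h"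
proof -
  have "\<not> h dvd 1" unfolding assms(2) by simp
  then show ?thesis unfolding prime_elem_def assms(2) using assms(1) by simp
qed

lemma monic_prime_dvd_eq:
  fixes p q :: "'a::field poly"
  assumes "prime_elem p" "prime_elem q" "lead_coeff p = 1" "lead_coeff q = 1" "p dvd q"
  shows "p = q"
proof -
  from assms(5) obtain k where k: "q = p * k" by (elim dvdE)
  have "\<not> p dvd 1" using assms(1) by (rule prime_elem_not_unit)
  then have "k dvd 1"
    using prime_elem_imp_irreducible[OF assms(2)] k by (metis irreducibleD)
  then obtain c where c: "k = [:c:]" using is_unit_poly_iff[of k] by auto
  have "lead_coeff q = c * lead_coeff p" unfolding k c by (simp only: lead_coeff_mult) simp
  then have "c = 1" using assms(3,4) by simp
  then show ?thesis using c k by simp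
qed

lemma prod_monic_primes_dvd:
  fixes q :: "'a::field poly"
  assumes "finite S" "\<And>p. p \<in> S \<Longrightarrow> prime_elem p \<and> lead_coeff p = 1 \<and> p dvd q"
  shows "\<Prod>S dvd q"
  using assms
proof (induction S rule: finite_induct)
  case (insert p S)
  then obtain k where k: "q = \<Prod>S * k" by (auto elim!: dvdE)
  have p: "prime_elem p" "lead_coeff p = 1" "p dvd \<Prod>S * k"
    using insert.prems[of p] k by auto
  have "\<not> p dvd \<Prod>S"
  proof
    assume "p dvd \<Prod>S"
    with insert.hyps(1) have "\<exists>p'\<in>S. p dvd p'"
    proof (induction S rule: finite_induct)
      case empty
      then show ?case using prime_elem_not_unit[OF p(1)] by simp
    qed (use p(1) in \<open>auto simp: prime_elem_dvd_mult_iff\<close>)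
    then obtain p' where "p' \<in> S" "p dvd p'" by blast
    then show False
      using monic_prime_dvd_eq[of p p'] insert p by auto
  qed
  then have "p dvd k" using p by (simp add: prime_elem_dvd_mult_iff)
  then show ?case using insert.hyps k by (simp add: mult.commute mult_dvd_mono)
qed simp

section \<open>Irreducible factors of \<open>x\<^sup>n - 1\<close>\<close>

lemma root_of_unity_inverse [simp]: "inverse z ^ n = 1" if "z ^ n = 1" for z :: "'a::field"
  using that by (simp add: power_inverse)

lemma root_of_unity_power_pred:
  fixes z :: "'a::field"
  assumes "z ^ n = 1" "0 < n"
  shows "z ^ (n - Suc 0) = inverse z"
proof -
  have "z * z ^ (n - Suc 0) = 1" using assms by (cases n) auto
  then show ?thesis by (metis inverse_unique)
qed

text \<open>
  The setting at one index \<open>j\<close>: an irreducible factor \<open>g\<close> of \<open>x\<^sup>n - 1\<close> with a chosen root \<open>z\<close>.  The facts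
  below that matter are that polynomials of degree less than \<open>deg g\<close> take each value in \<open>K[z]\<close>, for the ground field \<open>K\<close>, exactly
  once, both as values at \<open>z\<close> and as values at \<open>1/z\<close>.
\<close>

locale unity_factor =
  fixes n :: nat and g :: "'a::field poly" and z :: "'a alg_closure"
  assumes of_nat_nonzero: "of_nat n \<noteq> (0 :: 'a)"
    and irreducible: "irreducible g"
    and factor_dvd: "g dvd Polynomial.monom 1 n - 1"
    and root: "ac_eval g z = 0"
begin

lemma unity: "z ^ n = 1"
proof -
  have "ac_eval (Polynomial.monom 1 n - 1) z = 0"
    using ac_eval_eq_0_iff_dvd[OF irreducible root] factor_dvd by blast
  then show ?thesis by simp
qed

lemma unity_inverse: "inverse z ^ n = 1"
  using unity by simp

lemma n_pos: "0 < n"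
  using of_nat_nonzero by (cases n) auto

lemma root_nonzero: "z \<noteq> 0"
  using unity n_pos by (auto simp: zero_power)

lemma power_pred: "z ^ (n - Suc 0) = inverse z"
  by (rule root_of_unity_power_pred[OF unity n_pos])

lemma power_pred_inverse: "inverse z ^ (n - Suc 0) = z"
  using root_of_unity_power_pred[OF unity_inverse n_pos] by simp

lemma degree_pos: "0 < degree g"
proof (rule ccontr)
  assume "\<not> 0 < degree g"
  then obtain c where "g = [:c:]" by (metis degree_eq_zeroE gr0I)
  then show False using root irreducible by auto
qed

lemma small_poly_eq_0:
  assumes "degree p < degree g" "ac_eval p z = 0"
  shows "p = 0"
  using assms ac_eval_eq_0_iff_dvd[OF irreducible root, of p] dvd_imp_degree_le[of g p] by fastforce

text \<open>
  The reflection of a polynomial that vanishes at \<open>1/z\<close> vanishes at \<open>z\<close>, and reflection does not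
  raise the degree.
\<close>
lemma small_poly_inverse_eq_0:
  assumes "degree p < degree g" "ac_eval p (inverse z) = 0"
  shows "p = 0"
proof -
  have "ac_eval (reflect_poly p) z = 0"
    using assms(2) root_nonzero by (simp add: ac_eval_reflect_poly)
  moreover have "degree (reflect_poly p) < degree g"
    using assms(1) degree_reflect_poly_le[of p] by simp
  ultimately show ?thesis using small_poly_eq_0 by fastforce
qed

lemma ac_eval_mod:
  assumes "ac_eval g y = 0"
  shows "ac_eval (p mod g) y = ac_eval p y"
proof -
  have "ac_eval p y = ac_eval (p div g * g + p mod g) y" by simp
  then show ?thesis unfolding ac_eval_add ac_eval_mult using assms by simp
qed

lemma degree_mod: "degree (p mod g) < degree g"
  using degree_mod_less[of g p] degree_pos by fastforce

lemma adjoin_poly: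
  assumes "c \<in> adjoin z"
  obtains p where "degree p < degree g" "ac_eval p z = c"
  using assms ac_eval_mod[OF root] degree_mod by (force simp: adjoin_def)

text \<open>
  Reading the coefficients of a representative of \<open>z\<^bsup>deg g - 1\<^esup> c\<close> backwards gives a polynomial
  whose value at \<open>1/z\<close> is \<open>c\<close>.
\<close>
lemma adjoin_poly_inverse:
  assumes "c \<in> adjoin z"
  obtains p where "degree p < degree g" "ac_eval p (inverse z) = c"
proof -
  from assms obtain b where b: "c = ac_eval b z" by (auto simp: adjoin_def)
  define d where "d = degree g - 1"
  define p where "p = (Polynomial.monom 1 d * b) mod g"
  have p: "ac_eval p z = z ^ d * c"
    by (simp add: p_def ac_eval_mod root b)
  have degp: "degree p \<le> d"
    using degree_mod[of "Polynomial.monom 1 d * b"] by (simp add: p_def d_def)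
  define q where "q = Polynomial.monom 1 (d - degree p) * reflect_poly p"
  have "degree q \<le> (d - degree p) + degree p"
    unfolding q_def by (rule order.trans[OF degree_mult_le])
      (intro add_mono degree_monom_le degree_reflect_poly_le)
  then have "degree q < degree g" using degp degree_pos by (simp add: d_def)
  moreover have "ac_eval q (inverse z) = inverse z ^ (d - degree p + degree p) * ac_eval p z"
    using root_nonzero by (simp add: q_def ac_eval_reflect_poly power_add)
  then have "ac_eval q (inverse z) = c"
    using degp root_nonzero by (simp add: p field_simps)
  ultimately show ?thesis using that by blast
qed

text \<open>\<open>1/z = z\<^bsup>n - 1\<^esup>\<close> is a polynomial in \<open>z\<close>.\<close>
lemma ac_eval_inverse_in_adjoin: "ac_eval p (inverse z) \<in> adjoin z"
  unfolding adjoin_def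
  by (auto intro!: exI[of _ "pcompose p (Polynomial.monom 1 (n - 1))"] simp: power_pred)

lemma nonzero: "g \<noteq> 0"
  using irreducible by auto

lemma recip_degree_le: "degree (monic_recip g) \<le> degree g"
  by (simp add: monic_recip_def degree_reflect_poly_le)

lemma recip_nonzero: "monic_recip g \<noteq> 0"
  using nonzero by (simp add: monic_recip_def)

lemma lead_coeff_recip: "lead_coeff (monic_recip g) = 1"
proof -
  have "lead_coeff (reflect_poly g) \<noteq> 0"
    using nonzero by (simp only: leading_coeff_0_iff reflect_poly_eq_0_iff not_False_eq_True)
  then show ?thesis
    unfolding monic_recip_def lead_coeff_smult by (simp del: leading_coeff_0_iff)
qed

text \<open>
  The reciprocal polynomial has the root \<open>1/z\<close>, its degree is at most that of \<open>g\<close>, and no nonzero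
  polynomial of smaller degree vanishes at \<open>1/z\<close>; so division with remainder shows that it is the
  minimal polynomial of \<open>1/z\<close>.  This also makes it prime.
\<close>
lemma recip_dvd_iff: "monic_recip g dvd p \<longleftrightarrow> ac_eval p (inverse z) = 0"
proof
  have root': "ac_eval (monic_recip g) (inverse z) = 0"
    using root root_nonzero by (simp add: ac_eval_monic_recip_eq_0_iff)
  show "ac_eval p (inverse z) = 0" if "monic_recip g dvd p"
    using that root' by (elim dvdE) simp
  show "monic_recip g dvd p" if p: "ac_eval p (inverse z) = 0"
  proof -
    have "ac_eval p (inverse z) = ac_eval (p div monic_recip g * monic_recip g + p mod monic_recip g) (inverse z)"
      by simp
    then have 0: "ac_eval (p mod monic_recip g) (inverse z) = 0"
      unfolding ac_eval_add ac_eval_mult using root' p by simp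
    have "p mod monic_recip g = 0"
      using small_poly_inverse_eq_0[OF _ 0] degree_mod_less[OF recip_nonzero, of p] recip_degree_le
      by linarith
    then show ?thesis by auto
  qed
qed

lemma dvd_iff: "g dvd p \<longleftrightarrow> ac_eval p z = 0"
  using ac_eval_eq_0_iff_dvd[OF irreducible root] by simp

lemma prime: "prime_elem g" and recip_prime: "prime_elem (monic_recip g)"
  using prime_elem_of_root[OF nonzero dvd_iff] prime_elem_of_root[OF recip_nonzero recip_dvd_iff] by auto

end

text \<open>
  Reflection is multiplicative and only changes the sign of \<open>x\<^sup>n - 1\<close>.
\<close>

lemma monic_recip_dvd:
  fixes g :: "'a::field poly"
  assumes dvd: "g dvd Polynomial.monom 1 n - 1" and n: "0 < n"
  shows "monic_recip g dvd Polynomial.monom 1 n - 1"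
proof -
  obtain h where h: "Polynomial.monom 1 n - 1 = g * h" using dvd by (elim dvdE)
  have deg: "degree (Polynomial.monom 1 n - 1 :: 'a poly) = n"
    using n degree_add_eq_left[of "- 1" "Polynomial.monom (1 :: 'a) n"] by (simp add: degree_monom_eq)
  have "reflect_poly (Polynomial.monom 1 n - 1) = - (Polynomial.monom 1 n - 1 :: 'a poly)"
    using n by (intro poly_eqI) (auto simp: coeff_reflect_poly deg coeff_1)
  then have "Polynomial.monom 1 n - 1 = reflect_poly g * - reflect_poly h"
    by (simp add: h reflect_poly_mult flip: minus_equation_iff)
  then have "reflect_poly g dvd Polynomial.monom 1 n - 1" by (metis dvd_triv_left)
  moreover have "g \<noteq> 0" using h n by (auto simp: monom_eq_1_iff)
  ultimately show ?thesis
    by (simp add: monic_recip_def smult_dvd)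
qed

lemma of_nat_nonzero_coprime:
  assumes "coprime CARD('a::{field,finite}) n"
  shows "of_nat n \<noteq> (0 :: 'a)"
proof
  assume "of_nat n = (0 :: 'a)"
  then have "CHAR('a) dvd n" by (simp add: of_nat_eq_0_iff_char_dvd)
  moreover have "CHAR('a) dvd CARD('a)" by (rule CHAR_dvd_CARD)
  ultimately have "CHAR('a) dvd 1" using assms by (metis coprime_common_divisor)
  then have "of_nat 1 = (0 :: 'a)" by (simp add: of_nat_eq_0_iff_char_dvd)
  then show False by simp
qed

text \<open>
  The first factor of \<open>e\<^sub>g\<close> is \<open>deg g \<cdot> g - x g'\<close>, as one sees by comparing coefficients; in this form
  its values at the roots of \<open>g\<close> are visible.
\<close>

lemma e_poly_factor:
  fixes g :: "'a::field poly"
  shows "(\<Sum>i<degree g. Polynomial.monom (Polynomial.coeff (pderiv (reflect_poly g)) i) (degree g - 1 - i))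
    = Polynomial.smult (of_nat (degree g)) g - pCons 0 (pderiv g)"
proof -
  define d where "d = degree g"
  have "(\<Sum>i<d. Polynomial.monom (Polynomial.coeff (pderiv (reflect_poly g)) i) (d - 1 - i))
      = (\<Sum>i<d. Polynomial.monom (of_nat (d - (d - Suc i)) * Polynomial.coeff g (d - Suc i)) (d - Suc i))"
    by (intro sum.cong refl) (auto simp: coeff_pderiv coeff_reflect_poly d_def[symmetric] Suc_diff_Suc)
  also have "\<dots> = (\<Sum>j<d. Polynomial.monom (of_nat (d - j) * Polynomial.coeff g j) j)"
    by (rule sum.nat_diff_reindex)
  finally have S: "(\<Sum>i<d. Polynomial.monom (Polynomial.coeff (pderiv (reflect_poly g)) i) (d - 1 - i))
      = (\<Sum>j<d. Polynomial.monom (of_nat (d - j) * Polynomial.coeff g j) j)" .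
  have "Polynomial.coeff (\<Sum>j<d. Polynomial.monom (of_nat (d - j) * Polynomial.coeff g j) j) k
      = Polynomial.coeff (Polynomial.smult (of_nat d) g - pCons 0 (pderiv g)) k" for k
  proof -
    have "Polynomial.coeff (\<Sum>j<d. Polynomial.monom (of_nat (d - j) * Polynomial.coeff g j) j) k
        = (if k < d then of_nat (d - k) * Polynomial.coeff g k else 0)"
      by (simp add: coeff_sum)
    also have "\<dots> = (of_nat d - of_nat k) * Polynomial.coeff g k"
      by (cases k d rule: linorder_cases) (auto simp: of_nat_diff coeff_eq_0 d_def)
    also have "\<dots> = Polynomial.coeff (Polynomial.smult (of_nat d) g - pCons 0 (pderiv g)) k"
      by (cases k) (simp_all add: coeff_pderiv algebra_simps)
    finally show ?thesis .
  qed
  then show ?thesis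
    unfolding d_def[symmetric] S by (rule poly_eqI)
qed

text \<open>
  Write \<open>x\<^sup>n - 1 = g h\<close>.  At a root of \<open>h\<close> that is not a root of \<open>g\<close> the factor \<open>h\<close> vanishes.  At a root
  \<open>z\<close> of \<open>g\<close>, differentiation gives \<open>g'(z) h(z) = n z\<^bsup>n-1\<^esup>\<close>, so \<open>e\<^sub>g(z) = z g'(z) h(z) / n = z\<^sup>n = 1\<close>.
\<close>

lemma ac_eval_e_poly:
  fixes g :: "'a::field poly"
  assumes dvd: "g dvd Polynomial.monom 1 n - 1" and n: "of_nat n \<noteq> (0 :: 'a)"
    and z: "z ^ n = 1"
  shows "ac_eval (e_poly n g) z = (if ac_eval g z = 0 then 1 else 0)"
proof -
  from dvd obtain h where h: "Polynomial.monom 1 n - 1 = g * h" by (elim dvdE)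
  have "n \<noteq> 0" using n by (cases n) auto
  then have "g \<noteq> 0" using h by (auto simp: monom_eq_1_iff)
  then have div: "(Polynomial.monom 1 n - 1) div g = h" using h by simp
  have gh: "ac_eval g z * ac_eval h z = 0"
    using arg_cong[OF h, of "\<lambda>p. ac_eval p z"] z by simp
  have "pderiv (Polynomial.monom 1 n - 1) = pderiv (g * h)" by (simp add: h)
  then have "Polynomial.monom (of_nat n) (n - 1) = g * pderiv h + h * pderiv g"
    by (simp add: pderiv_monom pderiv_diff pderiv_mult)
  from arg_cong[OF this, of "\<lambda>p. ac_eval p z"]
  have der: "of_nat n * z ^ (n - 1) = ac_eval g z * ac_eval (pderiv h) z + ac_eval h z * ac_eval (pderiv g) z"
    by simp
  have val: "ac_eval (e_poly n g) z =
      - inverse (of_nat n) * ((of_nat (degree g) * ac_eval g z - z * ac_eval (pderiv g) z) * ac_eval h z)"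
    unfolding e_poly_def e_poly_factor div by simp
  show ?thesis
  proof (cases "ac_eval g z = 0")
    case True
    have "z * (ac_eval h z * ac_eval (pderiv g) z) = of_nat n * z ^ n"
      using der True \<open>n \<noteq> 0\<close> by (cases n) (simp_all add: algebra_simps)
    moreover have "of_nat n \<noteq> (0 :: 'a alg_closure)"
      using n by (metis to_ac_eq_0_iff to_ac_of_nat)
    ultimately show ?thesis
      using True z by (simp add: val field_simps)
  next
    case False
    then show ?thesis using gh val by simp
  qed
qed

section \<open>Evaluation of elements of the group algebra\<close>

text \<open>
  The character \<open>a\<^sup>m \<mapsto> z\<^sup>m\<close> of the rotation subgroup.  It is a homomorphism if \<open>z\<^sup>n = 1\<close>.
\<close>

definition dih_char :: "'a::field alg_closure \<Rightarrow> 'n::nontriv mod_ring \<Rightarrow> 'a alg_closure" where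
  "dih_char z m = z ^ nat (to_int_mod_ring m)"

definition rot_at :: "'a::field alg_closure \<Rightarrow> ('n::nontriv, 'a) dihedral_algebra \<Rightarrow> 'a alg_closure" where
  "rot_at z w = ac_eval (P_part w) z"

definition ref_at :: "'a::field alg_closure \<Rightarrow> ('n::nontriv, 'a) dihedral_algebra \<Rightarrow> 'a alg_closure" where
  "ref_at z w = ac_eval (Q_part w) z"

lemma dih_char_of_nat:
  assumes "z ^ CARD('n::nontriv) = 1"
  shows "dih_char z (of_nat i :: 'n mod_ring) = z ^ i"
proof -
  have z: "z ^ (i mod CARD('n)) = z ^ i"
  proof -
    have "z ^ i = z ^ (CARD('n) * (i div CARD('n)) + i mod CARD('n))" by simp
    also have "\<dots> = z ^ (i mod CARD('n))"
      using assms unfolding power_add power_mult by simp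
    finally show ?thesis by simp
  qed
  have "(of_nat (i mod CARD('n)) :: 'n mod_ring) = of_nat i"
  proof -
    have "(of_nat i :: 'n mod_ring) = of_nat (CARD('n) * (i div CARD('n)) + i mod CARD('n))" by simp
    also have "\<dots> = of_nat (i mod CARD('n))"
      unfolding of_nat_add of_nat_mult of_nat_card_eq_0 by simp
    finally show ?thesis by simp
  qed
  then have "to_int_mod_ring (of_nat i :: 'n mod_ring) = int (i mod CARD('n))"
    by (metis (mono_tags, lifting) comp_apply of_nat_0_le_iff of_nat_less_iff of_nat_of_int_mod_ring
        to_int_mod_ring_of_int_mod_ring mod_less_divisor zero_less_card_finite)
  then show ?thesis by (simp add: dih_char_def z)
qed

lemma mod_ring_cases_nat:
  obtains i where "(m :: 'n::nontriv mod_ring) = of_nat i"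
  using range_of_nat_mod_ring by (metis UNIV_I imageE)

lemma dih_char_add:
  assumes "z ^ CARD('n::nontriv) = 1"
  shows "dih_char z (m + m' :: 'n mod_ring) = dih_char z m * dih_char z m'"
proof -
  obtain i j where ij: "m = of_nat i" "m' = of_nat j"
    by (metis mod_ring_cases_nat)
  have "m + m' = of_nat (i + j)" by (simp add: ij)
  then show ?thesis using assms
    by (simp only: ij dih_char_of_nat power_add)
qed

lemma dih_char_0 [simp]: "dih_char z 0 = 1"
  by (simp add: dih_char_def)

lemma dih_char_uminus:
  assumes "z ^ CARD('n::nontriv) = 1"
  shows "dih_char z (- m :: 'n mod_ring) = dih_char (inverse z) m"
proof -
  have "dih_char z m * dih_char z (- m) = 1"
    using dih_char_add[OF assms, of m "- m"] by simp
  then have "dih_char z (- m) = inverse (dih_char z m)"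
    by (metis inverse_unique)
  then show ?thesis by (simp add: dih_char_def power_inverse)
qed

lemma ac_eval_sum_monom:
  assumes "z ^ CARD('n::nontriv) = 1"
  shows "ac_eval (\<Sum>i<CARD('n). Polynomial.monom (h (of_nat i :: 'n mod_ring)) i) z
    = (\<Sum>m\<in>UNIV. to_ac (h m) * dih_char z m)"
proof -
  have "inj_on (of_nat :: nat \<Rightarrow> 'n mod_ring) {..<CARD('n)}"
    by (auto simp: inj_on_def of_nat_mod_ring_eq_iff)
  then show ?thesis unfolding range_of_nat_mod_ring
    by (subst sum.reindex) (simp_all add: dih_char_of_nat assms)
qed

lemma rot_at_altdef:
  assumes "z ^ CARD('n::nontriv) = 1"
  shows "rot_at z (w :: ('n, 'a::field) dihedral_algebra) =
    (\<Sum>m\<in>UNIV. to_ac (Poly_Mapping.lookup w (Dih 0 m)) * dih_char z m)"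
  unfolding rot_at_def P_part_def by (rule ac_eval_sum_monom[OF assms])

lemma ref_at_altdef:
  assumes "z ^ CARD('n::nontriv) = 1"
  shows "ref_at z (w :: ('n, 'a::field) dihedral_algebra) =
    (\<Sum>m\<in>UNIV. to_ac (Poly_Mapping.lookup w (Dih 1 m)) * dih_char z m)"
  unfolding ref_at_def Q_part_def by (rule ac_eval_sum_monom[OF assms])

lemma rot_at_add [simp]: "rot_at z (w + w') = rot_at z w + rot_at z w'"
  and ref_at_add [simp]: "ref_at z (w + w') = ref_at z w + ref_at z w'"
  by (simp_all add: rot_at_def ref_at_def P_part_def Q_part_def lookup_add algebra_simps
      sum.distrib flip: add_monom)

lemma rot_at_0 [simp]: "rot_at z 0 = 0"
  and ref_at_0 [simp]: "ref_at z 0 = 0"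
  by (simp_all add: rot_at_def ref_at_def P_part_def Q_part_def)

lemma rot_at_scale [simp]: "rot_at z (scale c w) = to_ac c * rot_at z w"
  and ref_at_scale [simp]: "ref_at z (scale c w) = to_ac c * ref_at z w"
  by (simp_all add: rot_at_def ref_at_def P_part_def Q_part_def lookup_scale algebra_simps
      sum_distrib_left)

lemma rot_at_diff [simp]: "rot_at z (w - w') = rot_at z w - rot_at z w'"
  using rot_at_add[of z "w - w'" w'] by (simp add: algebra_simps)

lemma ref_at_diff [simp]: "ref_at z (w - w') = ref_at z w - ref_at z w'"
  using ref_at_add[of z "w - w'" w'] by (simp add: algebra_simps)

lemma rot_at_sum [simp]: "rot_at z (sum h A) = (\<Sum>i\<in>A. rot_at z (h i))"
  and ref_at_sum [simp]: "ref_at z (sum h A) = (\<Sum>i\<in>A. ref_at z (h i))"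
  by (induction A rule: infinite_finite_induct) simp_all

text \<open>
  On group elements: the rotation \<open>a\<^sup>m\<close> has \<open>P(z) = z\<^sup>m\<close> and \<open>Q = 0\<close>, the reflection \<open>b a\<^sup>m\<close> has \<open>P = 0\<close> and
  \<open>Q(z) = z\<^sup>m\<close>.
\<close>

lemma rot_at_single:
  assumes "z ^ CARD('n::nontriv) = 1"
  shows "rot_at z (Poly_Mapping.single (Dih k (m :: 'n mod_ring)) c)
      = (if k = 0 then to_ac c * dih_char z m else 0)"
    and "ref_at z (Poly_Mapping.single (Dih k m) c)
      = (if k = 1 then to_ac c * dih_char z m else 0)"
proof -
  have *: "(\<Sum>m'\<in>UNIV. to_ac (if m = m' then c else 0) * dih_char z m') = to_ac c * dih_char z m"
    by (subst sum.cong[OF refl, of _ _ "\<lambda>m'. if m = m' then to_ac c * dih_char z m' else 0"]) auto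
  show "rot_at z (Poly_Mapping.single (Dih k m) c)
      = (if k = 0 then to_ac c * dih_char z m else 0)"
    by (auto simp: rot_at_altdef[OF assms] lookup_single when_def *)
  show "ref_at z (Poly_Mapping.single (Dih k m) c)
      = (if k = 1 then to_ac c * dih_char z m else 0)"
    by (auto simp: ref_at_altdef[OF assms] lookup_single when_def *)
qed

lemma dihedral_algebra_induct:
  fixes w :: "('n::nontriv, 'a::comm_ring_1) dihedral_algebra"
  assumes "\<And>g c. S (Poly_Mapping.single g c)" "\<And>w w'. S w \<Longrightarrow> S w' \<Longrightarrow> S (w + w')"
  shows "S w"
proof -
  have fin: "finite (UNIV :: 'n dihedral set)" 
    unfolding UNIV_dihedral UNIV_Times_UNIV[symmetric]
    by (intro finite_imageI finite_cartesian_product) (simp_all add: UNIV_bit)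
  have "w = (\<Sum>g\<in>UNIV. Poly_Mapping.single g (Poly_Mapping.lookup w g))"
    by (rule poly_mapping_eqI) (simp add: lookup_sum lookup_single when_def fin)
  moreover have "S (\<Sum>g\<in>A. Poly_Mapping.single g (Poly_Mapping.lookup w g))" if "finite A" for A
    using that by (induction A) (use assms assms(1)[of 0 0] in auto)
  ultimately show ?thesis using fin by metis
qed

text \<open>
  These are the entries \<open>P(z)\<close> and \<open>Q(z)\<close> of the matrix identity \<open>\<tau>(w w') = \<tau>(w) \<tau>(w')\<close>; the other two
  entries arise by exchanging \<open>z\<close> and \<open>1/z\<close>.  Both sides are biadditive, so it suffices to check them on
  multiples of group elements, where the inverse of \<open>z\<close> comes from moving \<open>b\<close> past a power of \<open>a\<close>.
\<close>

lemma rot_at_mult: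
  fixes w w' :: "('n::nontriv, 'a::field) dihedral_algebra"
  assumes z: "z ^ CARD('n) = 1"
  shows "rot_at z (w * w') = rot_at z w * rot_at z w' + ref_at (inverse z) w * ref_at z w'"
    and "ref_at z (w * w') = rot_at (inverse z) w * ref_at z w' + ref_at z w * rot_at z w'"
proof -
  note z' = root_of_unity_inverse[OF z]
  let ?S = "\<lambda>w w'. rot_at z (w * w') = rot_at z w * rot_at z w' + ref_at (inverse z) w * ref_at z w'
    \<and> ref_at z (w * w') = rot_at (inverse z) w * ref_at z w' + ref_at z w * rot_at z w'"
  have "?S w w'"
  proof (induction w rule: dihedral_algebra_induct)
    case (1 g c)
    show ?case
    proof (induction w' rule: dihedral_algebra_induct)
      case (1 g' c')
      show ?case
        by (cases g; cases g')
          (auto simp: mult_single rot_at_single[OF z] rot_at_single[OF z'] dih_char_add[OF z]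
            dih_char_uminus[OF z] split: bit.splits)
    next
      case (2 w1 w2)
      then show ?case by (simp add: algebra_simps)
    qed
  next
    case (2 w1 w2)
    then show ?case by (simp add: algebra_simps)
  qed
  then show "rot_at z (w * w') = rot_at z w * rot_at z w' + ref_at (inverse z) w * ref_at z w'"
    and "ref_at z (w * w') = rot_at (inverse z) w * ref_at z w' + ref_at z w * rot_at z w'"
    by simp_all
qed

lemma at_gens:
  assumes z: "z ^ CARD('n::nontriv) = 1"
  shows "rot_at z (1 :: ('n, 'a::field) dihedral_algebra) = 1"
    "ref_at z (1 :: ('n, 'a) dihedral_algebra) = 0"
    "rot_at z (gen_a ^ i :: ('n, 'a) dihedral_algebra) = z ^ i"
    "ref_at z (gen_a ^ i :: ('n, 'a) dihedral_algebra) = 0"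
    "rot_at z (gen_b :: ('n, 'a) dihedral_algebra) = 0"
    "ref_at z (gen_b :: ('n, 'a) dihedral_algebra) = 1"
    "rot_at z (gen_a_inv :: ('n, 'a) dihedral_algebra) = inverse z"
    "ref_at z (gen_a_inv :: ('n, 'a) dihedral_algebra) = 0"
  using dih_char_of_nat[OF z, of 1] dih_char_of_nat[OF root_of_unity_inverse[OF z], of 1]
  by (simp_all add: gen_a_power gen_b_def gen_a_inv_def zero_dihedral_def rot_at_single[OF z]
      dih_char_of_nat[OF z] dih_char_uminus[OF z] flip: single_one)

text \<open>
  On elements without reflection part, \<open>P(z)\<close> is multiplicative.
\<close>

lemma at_power:
  assumes z: "z ^ CARD('n::nontriv) = 1" and w: "\<And>z. z ^ CARD('n) = 1 \<Longrightarrow> ref_at z w = 0"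
  shows "rot_at z ((w :: ('n, 'a::field) dihedral_algebra) ^ i) = rot_at z w ^ i"
    and "ref_at z (w ^ i) = 0"
proof -
  have "rot_at z (w ^ i) = rot_at z w ^ i \<and> ref_at z (w ^ i) = 0"
    using z by (induction i) (simp_all add: at_gens rot_at_mult w)
  then show "rot_at z (w ^ i) = rot_at z w ^ i" "ref_at z (w ^ i) = 0" by simp_all
qed

lemma at_eval_at:
  assumes z: "z ^ CARD('n::nontriv) = 1" and w: "\<And>z. z ^ CARD('n) = 1 \<Longrightarrow> ref_at z w = 0"
  shows "rot_at z (eval_at p (w :: ('n, 'a::field) dihedral_algebra)) = ac_eval p (rot_at z w)"
    and "ref_at z (eval_at p w) = 0"
  by (simp_all add: eval_at_def at_power[OF z w] ac_eval_altdef)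

lemma at_eval_at_gen_a:
  assumes z: "z ^ CARD('n::nontriv) = 1"
  shows "rot_at z (eval_at p (gen_a :: ('n, 'a::field) dihedral_algebra)) = ac_eval p z"
    and "ref_at z (eval_at p (gen_a :: ('n, 'a::field) dihedral_algebra)) = 0"
  using at_gens(3,4)[where i = 1 and 'n = 'n and 'a = 'a] z
  by (simp_all add: at_eval_at)

lemma at_eval_at_gen_a_sym:
  assumes z: "z ^ CARD('n::nontriv) = 1"
  shows "rot_at z (eval_at p (gen_a + gen_a_inv :: ('n, 'a::field) dihedral_algebra))
      = ac_eval p (z + inverse z)"
    and "ref_at z (eval_at p (gen_a + gen_a_inv :: ('n, 'a::field) dihedral_algebra)) = 0"
  using at_gens(3,4)[where i = 1 and 'n = 'n and 'a = 'a] z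
  by (simp_all add: at_eval_at at_gens)

lemma at_gen_b_mult:
  fixes w :: "('n::nontriv, 'a::field) dihedral_algebra"
  assumes "z ^ CARD('n) = 1"
  shows "rot_at z (gen_b * w) = ref_at z w" "ref_at z (gen_b * w) = rot_at z w"
  by (simp_all add: rot_at_mult at_gens assms)

lemma at_e_elem:
  assumes "g dvd Polynomial.monom 1 CARD('n) - 1" and n: "of_nat CARD('n) \<noteq> (0 :: 'a)"
    and z: "z ^ CARD('n) = 1"
  shows "rot_at z (e_elem g :: ('n::nontriv, 'a::field) dihedral_algebra) = (if ac_eval g z = 0 then 1 else 0)"
    and "ref_at z (e_elem g :: ('n, 'a) dihedral_algebra) = 0"
  by (simp_all add: e_elem_def at_eval_at_gen_a z ac_eval_e_poly[OF assms])

text \<open>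
  Two elements agree at \<open>z\<close> if they have the same matrix \<open>\<tau>\<close>.
\<close>

definition agree_at :: "'a::field alg_closure \<Rightarrow> ('n::nontriv, 'a) dihedral_algebra
    \<Rightarrow> ('n, 'a) dihedral_algebra \<Rightarrow> bool" where
  "agree_at z w w' \<longleftrightarrow> rot_at z w = rot_at z w' \<and> ref_at z w = ref_at z w' \<and>
     rot_at (inverse z) w = rot_at (inverse z) w' \<and> ref_at (inverse z) w = ref_at (inverse z) w'"

lemma P_Q_part_eq_0D:
  fixes w :: "('n::nontriv, 'a::field) dihedral_algebra"
  assumes "P_part w = 0" "Q_part w = 0"
  shows "w = 0"
  by (subst P_Q_part) (simp add: assms eval_at_def scale_def)

section \<open>Bases of codes glued from their components\<close>

text \<open>
  Relations between indexed vectors detect repetitions as well, so independence of the family gives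
  injectivity together with independence of the image.
\<close>

lemma (in vector_space) independent_indexed:
  assumes fin: "finite A"
    and indep: "\<And>c. (\<Sum>i\<in>A. scale (c i) (h i)) = 0 \<Longrightarrow> \<forall>i\<in>A. c i = 0"
  shows "inj_on h A" and "independent (h ` A)"
proof -
  show inj: "inj_on h A"
  proof (rule inj_onI, rule ccontr)
    fix i j assume ij: "i \<in> A" "j \<in> A" "h i = h j" "i \<noteq> j"
    define c where "c k = (if k = i then 1 else if k = j then - 1 else 0 :: 'a)" for k
    have "(\<Sum>k\<in>A. scale (c k) (h k)) = (\<Sum>k\<in>{i, j}. scale (c k) (h k))"
      by (rule sum.mono_neutral_right) (use ij fin in \<open>auto simp: c_def\<close>)
    also have "\<dots> = 0" using ij by (simp add: c_def)
    finally have "c i = 0" using indep ij(1) by blast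
    then show False by (simp add: c_def)
  qed
  show "independent (h ` A)"
  proof
    assume "dependent (h ` A)"
    then obtain c v where c: "v \<in> h ` A" "c v \<noteq> 0" "(\<Sum>v\<in>h ` A. scale (c v) v) = 0"
      using dependent_finite[of "h ` A"] fin by auto
    then have "(\<Sum>i\<in>A. scale (c (h i)) (h i)) = 0"
      by (simp add: sum.reindex[OF inj])
    then show False using indep[of "\<lambda>i. c (h i)"] c(1,2) by auto
  qed
qed

definition gen_comb :: "(nat \<Rightarrow> 'a::comm_ring_1 poly) \<Rightarrow> ('n::nontriv, 'a) dihedral_algebra list
    \<Rightarrow> ('n, 'a) dihedral_algebra" where
  "gen_comb p xs = (\<Sum>k<length xs. eval_at (p k) gen_a * xs ! k)"

text \<open>
  All the generating sets of the theorem have this shape.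
\<close>

definition rotated :: "nat \<Rightarrow> ('n::nontriv, 'a::comm_ring_1) dihedral_algebra list
    \<Rightarrow> ('n, 'a) dihedral_algebra set" where
  "rotated d xs = {gen_a ^ i * xs ! k | i k. i < d \<and> k < length xs}"

lemma rotated_Nil [simp]: "rotated d [] = {}"
  by (auto simp: rotated_def)

lemma rotated_Cons:
  fixes x :: "('n::nontriv, 'a::comm_ring_1) dihedral_algebra"
  shows "rotated d (x # xs) = {gen_a ^ i * x | i. i < d} \<union> rotated d xs"
proof -
  have "{F i k | i k. i < d \<and> k < Suc l} = {F i 0 | i. i < d} \<union> {F i (Suc k) | i k. i < d \<and> k < l}"
    for F :: "nat \<Rightarrow> nat \<Rightarrow> ('n, 'a) dihedral_algebra" and l
    unfolding less_Suc_eq_0_disj by blast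
  then show ?thesis by (simp add: rotated_def)
qed

lemma less_2_Suc: "k < Suc (Suc 0) \<longleftrightarrow> k = 0 \<or> k = Suc 0"
  by auto

lemma rotated_gen_b:
  fixes x :: "('n::nontriv, 'a::comm_ring_1) dihedral_algebra"
  shows "rotated d [x, gen_b * x] = {gen_a ^ i * gen_b ^ k * x | i k. i < d \<and> k < (2::nat)}"
proof -
  have "{F i k | i k. i < d \<and> k < (2::nat)} = {F i 0 | i. i < d} \<union> {F i 1 | i. i < d}"
    for F :: "nat \<Rightarrow> nat \<Rightarrow> ('n, 'a) dihedral_algebra"
    unfolding less_2_cases_iff One_nat_def by blast
  then show ?thesis
    by (simp add: rotated_Cons mult.assoc)
qed

text \<open>
  \<open>xs\<close> yields a basis of the condition \<open>C\<close> as far as this can be seen at the root \<open>z\<close> of \<open>g\<close>: its elements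
  vanish at roots of unity not related to \<open>g\<close>, combinations whose coefficients are polynomials in \<open>a\<close> of degree less than
  \<open>deg g\<close> vanish at \<open>z\<close> only trivially, the generators lie in \<open>C\<close>, and every element of \<open>C\<close> agrees at
  \<open>z\<close> with such a combination.
\<close>

definition local_basis :: "'a::field poly \<Rightarrow> 'a alg_closure \<Rightarrow> ('n::nontriv, 'a) dihedral_algebra set
    \<Rightarrow> ('n, 'a) dihedral_algebra list \<Rightarrow> bool" where
  "local_basis g z C xs \<longleftrightarrow>
     (\<forall>x\<in>set xs. \<forall>y. y ^ CARD('n) = 1 \<longrightarrow> ac_eval g y \<noteq> 0 \<longrightarrow> ac_eval g (inverse y) \<noteq> 0
        \<longrightarrow> rot_at y x = 0 \<and> ref_at y x = 0) \<and>
     (\<forall>p. (\<forall>k<length xs. degree (p k) < degree g) \<longrightarrow> agree_at z (gen_comb p xs) 0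
        \<longrightarrow> (\<forall>k<length xs. p k = 0)) \<and>
     rotated (degree g) xs \<subseteq> C \<and>
     (\<forall>w\<in>C. \<exists>p. (\<forall>k<length xs. degree (p k) < degree g) \<and> agree_at z (gen_comb p xs) w)"

lemma local_basisD:
  fixes x :: "('n::nontriv, 'a::field) dihedral_algebra"
  assumes "local_basis g z C xs"
  shows "x \<in> set xs \<Longrightarrow> y ^ CARD('n) = 1 \<Longrightarrow> ac_eval g y \<noteq> 0 \<Longrightarrow> ac_eval g (inverse y) \<noteq> 0
      \<Longrightarrow> rot_at y x = 0 \<and> ref_at y x = 0"
    and "(\<And>k. k < length xs \<Longrightarrow> degree (p k) < degree g) \<Longrightarrow> agree_at z (gen_comb p xs) 0
      \<Longrightarrow> k < length xs \<Longrightarrow> p k = 0"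
    and "x \<in> rotated (degree g) xs \<Longrightarrow> x \<in> C"
    and "w \<in> C \<Longrightarrow> \<exists>p. (\<forall>k<length xs. degree (p k) < degree g) \<and> agree_at z (gen_comb p xs) w"
  using assms unfolding local_basis_def by blast+

lemma eval_at_gen_a_mult:
  fixes x :: "('n::nontriv, 'a::comm_ring_1) dihedral_algebra"
  assumes "degree p < d"
  shows "eval_at p gen_a * x = (\<Sum>i<d. scale (Polynomial.coeff p i) (gen_a ^ i * x))"
proof -
  have "eval_at p gen_a * x = (\<Sum>i\<le>degree p. scale (Polynomial.coeff p i) (gen_a ^ i * x))"
    by (simp add: eval_at_def sum_distrib_right scale_def mult.assoc)
  also have "\<dots> = (\<Sum>i<d. scale (Polynomial.coeff p i) (gen_a ^ i * x))"
    by (rule sum.mono_neutral_left) (use assms in \<open>auto simp: coeff_eq_0 scale_def\<close>)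
  finally show ?thesis .
qed

lemma gen_comb_in_span:
  fixes xs :: "('n::nontriv, 'a::field) dihedral_algebra list"
  assumes "\<And>k. k < length xs \<Longrightarrow> degree (p k) < d"
  shows "gen_comb p xs \<in> module.span scale (rotated d xs)"
  unfolding gen_comb_def
proof (rule dihedral_algebra.span_sum)
  fix k assume "k \<in> {..<length xs}"
  then have k: "k < length xs" by simp
  then have "gen_a ^ i * xs ! k \<in> rotated d xs" if "i < d" for i
    using that by (auto simp: rotated_def)
  then show "eval_at (p k) gen_a * xs ! k \<in> module.span scale (rotated d xs)"
    unfolding eval_at_gen_a_mult[OF assms[OF k]]
    by (intro dihedral_algebra.span_sum dihedral_algebra.span_scale dihedral_algebra.span_base) auto
qed

lemma at_gen_comb:
  fixes xs :: "('n::nontriv, 'a::field) dihedral_algebra list"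
  assumes z: "z ^ CARD('n) = 1"
  shows "rot_at z (gen_comb p xs) = (\<Sum>k<length xs. ac_eval (p k) z * rot_at z (xs ! k))"
    and "ref_at z (gen_comb p xs) = (\<Sum>k<length xs. ac_eval (p k) (inverse z) * ref_at z (xs ! k))"
  by (simp_all add: gen_comb_def rot_at_mult[OF z] at_eval_at_gen_a z)

text \<open>
  By the vanishing condition, a sum of combinations for the various \<open>j\<close> agrees at \<open>\<alpha> j\<close> with its \<open>j\<close>-th
  summand.  So local approximations of a code word add up to an element that agrees with the word
  everywhere, and a relation between all generators splits into one relation for each \<open>j\<close>.
\<close>

lemma glued_basis:
  fixes I :: "('n::nontriv, 'a::field) dihedral_algebra set"
    and C :: "nat \<Rightarrow> ('n, 'a) dihedral_algebra set"
  assumes fin: "finite J"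
    and code: "left_ideal I" and I: "I = {w. \<forall>j\<in>J. w \<in> C j}"
    and local: "\<And>j. j \<in> J \<Longrightarrow> local_basis (f j) (\<alpha> j) (C j) (xs j)"
    and cong: "\<And>j w w'. j \<in> J \<Longrightarrow> agree_at (\<alpha> j) w w' \<Longrightarrow> w \<in> C j \<Longrightarrow> w' \<in> C j"
    and deg: "\<And>j. j \<in> J \<Longrightarrow> 0 < degree (f j)"
    and unity: "\<And>j. j \<in> J \<Longrightarrow> \<alpha> j ^ CARD('n) = 1"
    and separate: "\<And>j j'. j \<in> J \<Longrightarrow> j' \<in> J \<Longrightarrow> j \<noteq> j' \<Longrightarrow>
      ac_eval (f j) (\<alpha> j') \<noteq> 0 \<and> ac_eval (f j) (inverse (\<alpha> j')) \<noteq> 0"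
    and faithful: "\<And>w w' :: ('n, 'a) dihedral_algebra. (\<And>j. j \<in> J \<Longrightarrow> agree_at (\<alpha> j) w w') \<Longrightarrow> w = w'"
  shows "is_basis (\<Union>j\<in>J. rotated (degree (f j)) (xs j)) I"
    and "j \<in> J \<Longrightarrow> j' \<in> J \<Longrightarrow> j \<noteq> j' \<Longrightarrow>
      rotated (degree (f j)) (xs j) \<inter> rotated (degree (f j')) (xs j') = {}"
proof -
  let ?T = "\<Union>j\<in>J. rotated (degree (f j)) (xs j)"
  have unity': "inverse (\<alpha> j) ^ CARD('n) = 1" if "j \<in> J" for j
    using unity[OF that] by simp
  have vanish: "rot_at (\<alpha> j) x = 0" "ref_at (\<alpha> j) x = 0"
      "rot_at (inverse (\<alpha> j)) x = 0" "ref_at (inverse (\<alpha> j)) x = 0"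
    if "j \<in> J" "j' \<in> J" "j \<noteq> j'" "x \<in> set (xs j')" for j j' x
    using local_basisD(1)[OF local[OF that(2)] that(4), of "\<alpha> j"]
      local_basisD(1)[OF local[OF that(2)] that(4), of "inverse (\<alpha> j)"]
      separate[of j' j] that unity[OF that(1)] unity'[OF that(1)] by auto
  have comb: "agree_at (\<alpha> j) (\<Sum>j\<in>J. gen_comb (p j) (xs j)) (gen_comb (p j) (xs j))"
    if j: "j \<in> J" for p j
    unfolding agree_at_def rot_at_sum ref_at_sum
    by (intro conjI; subst sum.remove[OF fin j])
      (auto intro!: sum.neutral simp: at_gen_comb unity[OF j] unity'[OF j] vanish[OF j])
  have zero: "0 \<in> I" and add: "x \<in> I \<Longrightarrow> y \<in> I \<Longrightarrow> x + y \<in> I" and mult: "x \<in> I \<Longrightarrow> w * x \<in> I" for x y w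
    using code by (auto simp: left_ideal_def)
  have sub: "dihedral_algebra.subspace I"
    by (auto simp: dihedral_algebra.subspace_def scale_def zero add mult)
  have "x \<in> I" if x: "x \<in> ?T" for x
  proof -
    from x obtain j where j: "j \<in> J" "x \<in> rotated (degree (f j)) (xs j)" by auto
    have "x \<in> C j'" if j': "j' \<in> J" for j'
    proof (cases "j' = j")
      case True
      then show ?thesis using local_basisD(3)[OF local] j by blast
    next
      case False
      obtain i k where ik: "x = gen_a ^ i * xs j ! k" "k < length (xs j)"
        using j(2) by (auto simp: rotated_def)
      have "agree_at (\<alpha> j') 0 x"
        using vanish[OF j' j(1) False, of "xs j ! k"] ik
        by (simp add: agree_at_def rot_at_mult[OF unity[OF j']] rot_at_mult[OF unity'[OF j']]
            at_gens unity[OF j'])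
      then show ?thesis using cong[OF j'] zero j' unfolding I by blast
    qed
    then show ?thesis unfolding I by blast
  qed
  then have "module.span scale ?T \<subseteq> I"
    by (intro dihedral_algebra.span_minimal sub) blast
  moreover have "I \<subseteq> module.span scale ?T"
  proof
    fix w assume w: "w \<in> I"
    have "\<forall>j\<in>J. \<exists>p. (\<forall>k<length (xs j). degree (p k) < degree (f j)) \<and> agree_at (\<alpha> j) (gen_comb p (xs j)) w"
      using local_basisD(4)[OF local] w unfolding I by blast
    then obtain p where p: "\<And>j k. j \<in> J \<Longrightarrow> k < length (xs j) \<Longrightarrow> degree (p j k) < degree (f j)"
      and agree: "\<And>j. j \<in> J \<Longrightarrow> agree_at (\<alpha> j) (gen_comb (p j) (xs j)) w"
      by metis
    have "w = (\<Sum>j\<in>J. gen_comb (p j) (xs j))"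
      by (rule faithful) (use comb agree in \<open>simp add: agree_at_def\<close>)
    also have "\<dots> \<in> module.span scale ?T"
    proof (rule dihedral_algebra.span_sum)
      fix j assume j: "j \<in> J"
      then have "rotated (degree (f j)) (xs j) \<subseteq> ?T" by blast
      from dihedral_algebra.span_mono[OF this] gen_comb_in_span[of "xs j" "p j", OF p[OF j]]
      show "gen_comb (p j) (xs j) \<in> module.span scale ?T" by blast
    qed
    finally show "w \<in> module.span scale ?T" .
  qed
  ultimately have span: "module.span scale ?T = I" by blast
  define A where "A = (SIGMA j:J. {..<length (xs j)} \<times> {..<degree (f j)})"
  define h where "h = (\<lambda>(j, k, i). gen_a ^ i * xs j ! k)"
  have finA: "finite A" using fin by (auto simp: A_def)
  have indep: "\<forall>m\<in>A. c m = 0" if c: "(\<Sum>m\<in>A. scale (c m) (h m)) = 0" for c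
  proof -
    define p where "p j k = (\<Sum>i<degree (f j). Polynomial.monom (c (j, k, i)) i)" for j k
    have degp: "degree (p j k) < degree (f j)" if "j \<in> J" for j k
      unfolding p_def by (rule degree_sum_less) (use deg[OF that] in \<open>auto intro: le_less_trans[OF degree_monom_le]\<close>)
    have coeffp: "Polynomial.coeff (p j k) i = c (j, k, i)" if "i < degree (f j)" for i j k
      using that by (simp add: p_def coeff_sum)
    have "(\<Sum>j\<in>J. gen_comb (p j) (xs j))
        = (\<Sum>j\<in>J. \<Sum>k<length (xs j). \<Sum>i<degree (f j). scale (c (j, k, i)) (h (j, k, i)))"
      by (intro sum.cong refl) (simp add: gen_comb_def eval_at_gen_a_mult[OF degp] coeffp h_def)
    also have "\<dots> = (\<Sum>m\<in>A. scale (c m) (h m))"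
      unfolding A_def using fin by (simp add: sum.Sigma sum.cartesian_product case_prod_unfold)
    finally have 0: "(\<Sum>j\<in>J. gen_comb (p j) (xs j)) = 0" using c by simp
    have "p j k = 0" if "j \<in> J" "k < length (xs j)" for j k
      using local_basisD(2)[OF local[OF that(1)], of "p j"] degp[OF that(1)] that comb[OF that(1), of p]
      unfolding 0 by (simp add: agree_at_def)
    then show ?thesis by (auto simp: A_def simp flip: coeffp)
  qed
  note ind = dihedral_algebra.independent_indexed[of A h, OF finA indep]
  have "h ` A = ?T"
  proof (intro equalityI subsetI)
    show "x \<in> ?T" if "x \<in> h ` A" for x
      using that by (auto simp: A_def h_def rotated_def)
    show "x \<in> h ` A" if "x \<in> ?T" for x
    proof -
      from that obtain j i k where "j \<in> J" "i < degree (f j)" "k < length (xs j)"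
          "x = gen_a ^ i * xs j ! k"
        by (auto simp: rotated_def)
      then show ?thesis by (auto simp: A_def h_def intro!: image_eqI[of _ _ "(j, k, i)"])
    qed
  qed
  then show "is_basis ?T I"
    using ind(2) span by (simp add: is_basis_def)
  show "rotated (degree (f j)) (xs j) \<inter> rotated (degree (f j')) (xs j') = {}"
    if "j \<in> J" "j' \<in> J" "j \<noteq> j'"
  proof (rule ccontr)
    assume "rotated (degree (f j)) (xs j) \<inter> rotated (degree (f j')) (xs j') \<noteq> {}"
    then obtain i k i' k' where "i < degree (f j)" "k < length (xs j)"
        "i' < degree (f j')" "k' < length (xs j')" "h (j, k, i) = h (j', k', i')"
      by (auto simp: rotated_def h_def)
    then show False
      using inj_onD[OF ind(1), of "(j, k, i)" "(j', k', i')"] that by (auto simp: A_def)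
  qed
qed

section \<open>Stacked generating matrices\<close>

lemma rows_matrix_append: "rows_matrix (ss @ ss') = rows_matrix ss @\<^sub>r rows_matrix ss'"
  by (rule eq_matI) (auto simp: rows_matrix_def append_rows_def mat_of_rows_def nth_append phi_def)

lemma stack_rows_matrices:
  "stack_rows (2 * CARD('n::nontriv)) (map (\<lambda>j. rows_matrix (ss j :: ('n, 'a::comm_ring_1) dihedral_algebra list)) js)
    = rows_matrix (concat (map ss js))"
proof (induction js)
  case Nil
  show ?case by (rule eq_matI) (simp_all add: stack_rows_def rows_matrix_def)
next
  case (Cons j js)
  then show ?case by (simp add: stack_rows_def rows_matrix_append)
qed

lemma distinct_concat_disjoint:
  assumes "distinct js" "\<And>j. j \<in> set js \<Longrightarrow> distinct (ss j)"
    and "\<And>j j'. j \<in> set js \<Longrightarrow> j' \<in> set js \<Longrightarrow> j \<noteq> j' \<Longrightarrow> set (ss j) \<inter> set (ss j') = {}"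
  shows "distinct (concat (map ss js))"
  using assms
proof (induction js)
  case (Cons j js)
  have "distinct (concat (map ss js))" using Cons by simp
  moreover have "set (ss j) \<inter> set (ss j') = {}" if "j' \<in> set js" for j'
    using Cons.prems(1) Cons.prems(3)[of j j'] that by auto
  ultimately show ?case using Cons.prems(2) by auto
qed simp

text \<open>
  Disjointness of the blocks ensures that the rows of the stacked matrix belong to pairwise
  distinct elements.
\<close>

lemma stacked_generating_matrix:
  fixes S :: "nat \<Rightarrow> ('n::nontriv, 'a::field) dihedral_algebra set"
  assumes fin: "finite J" and basis: "is_basis (\<Union>j\<in>J. S j) I"
    and disjoint: "\<And>j j'. j \<in> J \<Longrightarrow> j' \<in> J \<Longrightarrow> j \<noteq> j' \<Longrightarrow> S j \<inter> S j' = {}"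
    and M: "\<And>j. j \<in> J \<Longrightarrow> is_rows_matrix_of_set (M j) (S j)"
  shows "is_generating_matrix (stack_rows (2 * CARD('n)) (map M (sorted_list_of_set J))) I"
proof -
  obtain ss where ss: "\<And>j. j \<in> J \<Longrightarrow> distinct (ss j) \<and> set (ss j) = S j \<and> M j = rows_matrix (ss j)"
    using M unfolding is_rows_matrix_of_set_def by metis
  let ?js = "sorted_list_of_set J"
  have "map M ?js = map (\<lambda>j. rows_matrix (ss j)) ?js"
    using ss fin by simp
  then have "stack_rows (2 * CARD('n)) (map M ?js) = rows_matrix (concat (map ss ?js))"
    by (simp only: stack_rows_matrices)
  moreover have "distinct (concat (map ss ?js))"
    by (rule distinct_concat_disjoint) (use ss disjoint fin in auto)
  moreover have "set (concat (map ss ?js)) = (\<Union>j\<in>J. S j)"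
    using ss fin by auto
  ultimately show ?thesis
    using basis unfolding is_generating_matrix_def by metis
qed

section \<open>Bases in a single component\<close>

lemma local_basis_zero:
  fixes C :: "('n::nontriv, 'a::field) dihedral_algebra set"
  assumes C: "\<And>w. w \<in> C \<Longrightarrow> agree_at z 0 w"
  shows "local_basis g z C []"
  using C by (auto simp: local_basis_def rotated_def gen_comb_def)

text \<open>
  As \<open>e\<^sub>g\<close> is \<open>1\<close> at both \<open>z\<close> and \<open>1/z\<close>, the values of \<open>p(a) e\<^sub>g + q(a) b e\<^sub>g\<close> are \<open>p(z), p(1/z)\<close> for the
  rotation part and \<open>q(1/z), q(z)\<close> for the reflection part.
\<close>

lemma local_basis_full_self:
  fixes C :: "('n::nontriv, 'a::field) dihedral_algebra set"
  assumes uf: "unity_factor CARD('n) g z" and self: "ac_eval g (inverse z) = 0"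
    and C: "\<And>w. w \<in> C"
  shows "local_basis g z C [e_elem g, gen_b * e_elem g]"
proof -
  interpret unity_factor "CARD('n)" g z by fact
  note e = at_e_elem[OF factor_dvd of_nat_nonzero] at_gen_b_mult
  note ez = e[OF unity] e[OF unity_inverse]
  have "\<exists>p. (\<forall>k<Suc (Suc 0). degree (p k) < degree g) \<and>
      agree_at z (gen_comb p [e_elem g, gen_b * e_elem g]) w"
    for w :: "('n, 'a) dihedral_algebra"
    by (rule exI[of _ "\<lambda>k. (if k = 0 then P_part w
         else pcompose (Q_part w) (Polynomial.monom 1 (CARD('n) - 1))) mod g"])
      (auto simp: less_2_Suc agree_at_def at_gen_comb[OF unity] at_gen_comb[OF unity_inverse] ez
        lessThan_Suc root self ac_eval_mod degree_mod power_pred power_pred_inverse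
        rot_at_def[of _ w] ref_at_def[of _ w] simp del: power_inverse)
  then show ?thesis
    unfolding local_basis_def
    by (auto simp: agree_at_def at_gen_comb[OF unity] at_gen_comb[OF unity_inverse] e ez lessThan_Suc
        less_2_Suc C root self small_poly_eq_0 small_poly_inverse_eq_0)
qed

text \<open>
  If \<open>1/z\<close> is not a root of \<open>g\<close>, each of the four generators is nonzero at exactly one of the four
  positions of the matrix \<open>\<tau>\<close>.
\<close>

lemma local_basis_full_pair:
  fixes C :: "('n::nontriv, 'a::field) dihedral_algebra set"
  assumes uf: "unity_factor CARD('n) g z" and pair: "ac_eval g (inverse z) \<noteq> 0"
    and C: "\<And>w. w \<in> C"
  shows "local_basis g z C [e_elem g, gen_b * e_elem g, e_elem (monic_recip g), gen_b * e_elem (monic_recip g)]"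
proof -
  interpret unity_factor "CARD('n)" g z by fact
  note e = at_e_elem[OF factor_dvd of_nat_nonzero] at_gen_b_mult
    at_e_elem[OF monic_recip_dvd[OF factor_dvd n_pos] of_nat_nonzero]
  have nonzero: "y \<noteq> 0" if "y ^ CARD('n) = 1" for y :: "'a alg_closure"
    using that by (auto simp: power_0_left)
  note recip = ac_eval_monic_recip_eq_0_iff[OF nonzero]
  note ez = e[OF unity] e[OF unity_inverse] recip[OF unity] recip[OF unity_inverse]
  let ?xs = "[e_elem g, gen_b * e_elem g, e_elem (monic_recip g), gen_b * e_elem (monic_recip g)]"
  have "\<exists>p. (\<forall>k<Suc (Suc (Suc (Suc 0))). degree (p k) < degree g) \<and> agree_at z (gen_comb p ?xs) w"
    for w :: "('n, 'a) dihedral_algebra"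
  proof -
    obtain p0 where p0: "degree p0 < degree g" "ac_eval p0 z = rot_at z w"
      using adjoin_poly[OF ac_eval_in_adjoin] by (metis rot_at_def)
    obtain p1 where p1: "degree p1 < degree g" "ac_eval p1 (inverse z) = ref_at z w"
      using adjoin_poly_inverse[OF ac_eval_in_adjoin] by (metis ref_at_def)
    obtain p2 where p2: "degree p2 < degree g" "ac_eval p2 (inverse z) = rot_at (inverse z) w"
      using adjoin_poly_inverse[OF ac_eval_inverse_in_adjoin] by (metis rot_at_def)
    obtain p3 where p3: "degree p3 < degree g" "ac_eval p3 z = ref_at (inverse z) w"
      using adjoin_poly[OF ac_eval_inverse_in_adjoin] by (metis ref_at_def)
    show ?thesis
      by (rule exI[of _ "\<lambda>k. [p0, p1, p2, p3] ! k"])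
        (auto simp: less_Suc_eq_0_disj agree_at_def at_gen_comb[OF unity] at_gen_comb[OF unity_inverse] ez
          lessThan_Suc root pair p0 p1 p2 p3)
  qed
  then show ?thesis
    unfolding local_basis_def
    by (auto simp: agree_at_def at_gen_comb[OF unity] at_gen_comb[OF unity_inverse] e ez lessThan_Suc
        less_Suc_eq_0_disj C root pair small_poly_eq_0 small_poly_inverse_eq_0 recip)
qed

text \<open>
  At \<open>z = \<plusminus>1\<close> the matrix \<open>\<tau>\<close> consists of \<open>P(z)\<close> and \<open>Q(z)\<close> only, and the ideal generated by \<open>1 + s h\<close> is
  the line \<open>Q(z) = s P(z)\<close>.
\<close>

lemma local_basis_cyc:
  fixes C :: "('n::nontriv, 'a::field) dihedral_algebra set"
  assumes uf: "unity_factor CARD('n) g z" and z: "inverse z = z" and g: "degree g = 1"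
    and x: "x = e_elem g + gen_b * e_elem g \<and> s = 1 \<or> x = e_elem g - gen_b * e_elem g \<and> s = - 1"
    and C: "\<And>w. w \<in> C \<longleftrightarrow> ref_at z w = s * rot_at z w"
  shows "local_basis g z C [x]"
proof -
  interpret unity_factor "CARD('n)" g z by fact
  note e = at_e_elem[OF factor_dvd of_nat_nonzero] at_gen_b_mult
  have x_at: "rot_at y x = (if ac_eval g y = 0 then 1 else 0)" "ref_at y x = (if ac_eval g y = 0 then s else 0)"
    if "y ^ CARD('n) = 1" for y
    using x by (auto simp: e[OF that])
  have "\<exists>p. (\<forall>k<Suc 0. degree (p k) < degree g) \<and> agree_at z (gen_comb p [x]) w" if "w \<in> C" for w
    by (rule exI[of _ "\<lambda>_. P_part w mod g"])
      (use that C in \<open>simp_all add: agree_at_def z at_gen_comb[OF unity] x_at[OF unity] lessThan_Suc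
        root ac_eval_mod degree_mod rot_at_def[of _ w] del: One_nat_def\<close>)
  moreover have "gen_a ^ 0 * x \<in> C"
    using x_at[OF unity] root by (simp add: C)
  ultimately show ?thesis
    unfolding local_basis_def using g
    by (auto simp: agree_at_def at_gen_comb[OF unity] x_at x_at[OF unity] lessThan_Suc rotated_Cons
        root small_poly_eq_0)
qed

text \<open>
  The matrix \<open>\<tau>(x)\<close> has the first row \<open>(u(z), v(1/z))\<close> and the second row \<open>0\<close>.  Multiplication by
  \<open>a\<^sup>i\<close> scales this row by \<open>z\<^sup>i\<close>, and \<open>b\<close> exchanges the rows.
\<close>

lemma local_basis_pair:
  fixes C :: "('n::nontriv, 'a::field) dihedral_algebra set"
  assumes uf: "unity_factor CARD('n) g z" and pair: "ac_eval g (inverse z) \<noteq> 0"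
    and nontrivial: "ac_eval u z \<noteq> 0 \<or> ac_eval v (inverse z) \<noteq> 0"
    and x: "x = eval_at u gen_a * e_elem g + gen_b * eval_at v gen_a * e_elem (monic_recip g)"
    and C: "\<And>w. w \<in> C \<longleftrightarrow> (\<exists>k\<in>adjoin z. \<exists>t\<in>adjoin z.
        rot_at z w = k * ac_eval u z \<and> ref_at (inverse z) w = k * ac_eval v (inverse z) \<and>
        ref_at z w = t * ac_eval u z \<and> rot_at (inverse z) w = t * ac_eval v (inverse z))"
  shows "local_basis g z C [x, gen_b * x]"
proof -
  interpret unity_factor "CARD('n)" g z by fact
  have nonzero: "y \<noteq> 0" if "y ^ CARD('n) = 1" for y :: "'a alg_closure"
    using that by (auto simp: power_0_left)
  have x_at: "rot_at y x = (if ac_eval g y = 0 then ac_eval u y else 0)"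
      "ref_at y x = (if ac_eval g (inverse y) = 0 then ac_eval v y else 0)"
    if y: "y ^ CARD('n) = 1" for y
    using root_of_unity_inverse[OF y]
    by (simp_all add: x rot_at_mult[OF y] at_gens(5,6)[OF y] at_gens(5,6)[OF root_of_unity_inverse[OF y]]
        at_eval_at_gen_a y at_e_elem[OF factor_dvd of_nat_nonzero]
        at_e_elem[OF monic_recip_dvd[OF factor_dvd n_pos] of_nat_nonzero] ac_eval_monic_recip_eq_0_iff[OF nonzero])
  note xz = x_at[OF unity] x_at[OF unity_inverse]
    at_gen_b_mult[OF unity] at_gen_b_mult[OF unity_inverse]
  note comb = at_gen_comb[OF unity] at_gen_comb[OF unity_inverse]
  have span: "\<exists>p. (\<forall>k<Suc (Suc 0). degree (p k) < degree g) \<and> agree_at z (gen_comb p [x, gen_b * x]) w"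
    if w: "w \<in> C" for w
  proof -
    obtain k t where kt: "k \<in> adjoin z" "t \<in> adjoin z"
      and w: "rot_at z w = k * ac_eval u z" "ref_at (inverse z) w = k * ac_eval v (inverse z)"
        "ref_at z w = t * ac_eval u z" "rot_at (inverse z) w = t * ac_eval v (inverse z)"
      using w unfolding C by blast
    obtain p q where p: "degree p < degree g" "ac_eval p z = k"
      and q: "degree q < degree g" "ac_eval q (inverse z) = t"
      using adjoin_poly[OF kt(1)] adjoin_poly_inverse[OF kt(2)] by metis
    show ?thesis
      by (rule exI[of _ "\<lambda>k. [p, q] ! k"])
        (auto simp: less_Suc_eq_0_disj agree_at_def comb xz lessThan_Suc root pair p q w)
  qed
  have "rotated (degree g) [x, gen_b * x] \<subseteq> C"
  proof -
    have "gen_a ^ i * x \<in> C" "gen_a ^ i * (gen_b * x) \<in> C" for i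
    proof -
      have 0: "0 \<in> adjoin z" using ac_eval_in_adjoin[of 0] by simp
      have i: "z ^ i \<in> adjoin z" using ac_eval_in_adjoin[of "Polynomial.monom 1 i"] by simp
      have i': "inverse z ^ i \<in> adjoin z"
        using ac_eval_inverse_in_adjoin[of "Polynomial.monom 1 i"] by simp
      show "gen_a ^ i * x \<in> C"
        unfolding C by (rule bexI[OF _ i], rule bexI[OF _ 0])
          (simp add: rot_at_mult[OF unity] rot_at_mult[OF unity_inverse] at_gens[OF unity]
            at_gens[OF unity_inverse] xz root pair del: power_inverse)
      show "gen_a ^ i * (gen_b * x) \<in> C"
        unfolding C by (rule bexI[OF _ 0], rule bexI[OF _ i'])
          (simp add: rot_at_mult[OF unity] rot_at_mult[OF unity_inverse] at_gens[OF unity]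
            at_gens[OF unity_inverse] xz root pair del: power_inverse)
    qed
    then show ?thesis by (auto simp: rotated_Cons)
  qed
  with span show ?thesis
    unfolding local_basis_def using nontrivial
    by (auto simp: agree_at_def comb xz x_at lessThan_Suc less_2_Suc at_gen_b_mult
        root pair small_poly_eq_0 small_poly_inverse_eq_0)
qed

text \<open>
  Two distinct points have an invertible Vandermonde matrix.
\<close>

lemma vandermonde_cancel:
  fixes z z' :: "'a::field"
  assumes "A + B = A' + B'" "z * A + z' * B = z * A' + z' * B'" "z \<noteq> z'"
  shows "A = A'" "B = B'"
proof -
  have "(z - z') * (A - A') = (z * A + z' * B) - z' * (A + B) - ((z * A' + z' * B') - z' * (A' + B'))"
    by (simp add: algebra_simps)
  also have "\<dots> = 0" using assms(1,2) by simp
  finally show "A = A'" using assms(3) by simp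
  then show "B = B'" using assms(1) by simp
qed

text \<open>
  The condition \<open>C\<close> says that \<open>\<tau>(w) Z\<close> has the rows \<open>(k - z t) (V, -U)\<close> and \<open>(k - t/z) (V, -U)\<close>; the
  factor \<open>(1 + b)\<close> makes both rows of \<open>\<tau>(x)\<close> equal, and \<open>F\<close> and \<open>G\<close> supply the denominator \<open>y\<^sup>2 - 1\<close> of \<open>W\<close>.
\<close>

lemma local_basis_self:
  fixes C :: "('n::nontriv, 'a::field) dihedral_algebra set"
  assumes uf: "unity_factor CARD('n) g z" and self: "ac_eval g (inverse z) = 0"
    and z_neq: "z \<noteq> inverse z"
    and F: "[:- 1, 1:] * F + g * F' = 1" and G: "[:1, 1:] * G + g * G' = 1"
    and uv: "U = ac_eval u (z + inverse z)" "V = ac_eval v (z + inverse z)" "U \<noteq> 0 \<or> V \<noteq> 0"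
    and x: "x = (1 + gen_b) * eval_at F gen_a * eval_at G gen_a
        * (gen_a * eval_at u (gen_a + gen_a_inv) - eval_at v (gen_a + gen_a_inv)) * e_elem g"
    and C: "\<And>w. w \<in> C \<longleftrightarrow> (\<exists>k\<in>adjoin (z + inverse z). \<exists>t\<in>adjoin (z + inverse z).
        rot_at z w + ref_at (inverse z) w = (k - z * t) * V \<and>
        z * rot_at z w + inverse z * ref_at (inverse z) w = (k - z * t) * U \<and>
        ref_at z w + rot_at (inverse z) w = (k - inverse z * t) * V \<and>
        z * ref_at z w + inverse z * rot_at (inverse z) w = (k - inverse z * t) * U)"
  shows "local_basis g z C [x]"
proof -
  interpret unity_factor "CARD('n)" g z by fact
  note comb = at_gen_comb[OF unity] at_gen_comb[OF unity_inverse]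
  define W where "W y = ac_eval F y * ac_eval G y * (y * ac_eval u (y + inverse y) - ac_eval v (y + inverse y))"
    for y
  have x_at: "rot_at y x = (if ac_eval g y = 0 then W y else 0)" "ref_at y x = rot_at y x"
    if y: "y ^ CARD('n) = 1" for y
  proof -
    note y' = root_of_unity_inverse[OF y]
    have *: "rot_at y (gen_a :: ('n, 'a) dihedral_algebra) = y" "ref_at y (gen_a :: ('n, 'a) dihedral_algebra) = 0"
      using at_gens(3,4)[OF y, of 1] by simp_all
    have **: "rot_at (inverse y) (gen_a :: ('n, 'a) dihedral_algebra) = inverse y"
        "ref_at (inverse y) (gen_a :: ('n, 'a) dihedral_algebra) = 0"
      using at_gens(3,4)[OF y', of 1] by simp_all
    show "rot_at y x = (if ac_eval g y = 0 then W y else 0)" "ref_at y x = rot_at y x"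
      by (simp_all add: x W_def rot_at_mult[OF y] rot_at_mult[OF y'] at_gens(1,2,5-8)[OF y]
          at_gens(1,2,5-8)[OF y'] * ** at_eval_at_gen_a y at_eval_at_gen_a_sym
          at_e_elem[OF factor_dvd of_nat_nonzero])
  qed
  have xz: "rot_at z x = W z" "ref_at z x = W z"
    "rot_at (inverse z) x = W (inverse z)" "ref_at (inverse z) x = W (inverse z)"
    using x_at[OF unity] x_at[OF unity_inverse] root self by simp_all
  have FG: "ac_eval F y * ac_eval G y * (y * y - 1) = 1" if "ac_eval g y = 0" for y
  proof -
    have "(y - 1) * ac_eval F y = 1" "(y + 1) * ac_eval G y = 1"
      using arg_cong[OF F, of "\<lambda>p. ac_eval p y"] arg_cong[OF G, of "\<lambda>p. ac_eval p y"] that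
      by (simp_all add: algebra_simps)
    then have "((y - 1) * ac_eval F y) * ((y + 1) * ac_eval G y) = 1" by simp
    then show ?thesis by (simp add: algebra_simps)
  qed
  have W_eq: "W y * (y * y - 1) = y * ac_eval u (y + inverse y) - ac_eval v (y + inverse y)"
    if "ac_eval g y = 0" for y
  proof -
    have "W y * (y * y - 1) = (ac_eval F y * ac_eval G y * (y * y - 1))
        * (y * ac_eval u (y + inverse y) - ac_eval v (y + inverse y))"
      unfolding W_def by (simp only: mult_ac)
    then show ?thesis unfolding FG[OF that] by simp
  qed
  have W_z: "W z * (z * z - 1) = z * U - V"
    and W_z': "W (inverse z) * (inverse z * inverse z - 1) = inverse z * U - V"
    using W_eq[OF root] W_eq[OF self] by (simp_all add: uv(1,2) add.commute)
  have cancel: "z * (inverse z * y) = y" for y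
    using root_nonzero by (simp flip: mult.assoc)
  have zz: "z * z - 1 \<noteq> 0"
    using z_neq root_nonzero by (auto simp: field_simps)
  have "W (inverse z) * (1 - z * z) = z * U - z * z * V"
    using arg_cong[OF W_z', of "\<lambda>y. z * z * y"] root_nonzero
    by (simp add: algebra_simps cancel)
  then have W_z'': "W (inverse z) * (z * z - 1) = z * z * V - z * U"
    by (simp add: algebra_simps)
  have WV: "W z + W (inverse z) = V"
  proof -
    have "(W z + W (inverse z)) * (z * z - 1) = V * (z * z - 1)"
      unfolding distrib_right W_z W_z'' by (simp add: algebra_simps)
    then show ?thesis using zz by simp
  qed
  have WU: "z * W z + inverse z * W (inverse z) = U"
  proof -
    have "(z * W z + inverse z * W (inverse z)) * (z * z - 1)
        = z * (W z * (z * z - 1)) + inverse z * (W (inverse z) * (z * z - 1))"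
      by (simp only: algebra_simps)
    also have "\<dots> = U * (z * z - 1)"
      unfolding W_z W_z'' using root_nonzero by (simp add: field_simps)
    finally show ?thesis using zz by simp
  qed
  have V_split: "c * V = c * W z + c * W (inverse z)" for c
    by (simp only: WV[symmetric] distrib_left)
  have U_split: "c * U = z * (c * W z) + inverse z * (c * W (inverse z))" for c
    by (simp only: WU[symmetric] distrib_left mult.left_commute)
  have span: "\<exists>p. (\<forall>k<Suc 0. degree (p k) < degree g) \<and> agree_at z (gen_comb p [x]) w"
    if w: "w \<in> C" for w
  proof -
    obtain k t where kt: "k \<in> adjoin (z + inverse z)" "t \<in> adjoin (z + inverse z)"
      and w: "rot_at z w + ref_at (inverse z) w = (k - z * t) * V"
        "z * rot_at z w + inverse z * ref_at (inverse z) w = (k - z * t) * U"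
        "ref_at z w + rot_at (inverse z) w = (k - inverse z * t) * V"
        "z * ref_at z w + inverse z * rot_at (inverse z) w = (k - inverse z * t) * U"
      using w unfolding C by blast
    obtain K S where K: "k = ac_eval K (z + inverse z)" and S: "t = ac_eval S (z + inverse z)"
      using kt by (auto simp: adjoin_def)
    define b where "b = Polynomial.monom (1::'a) 1 + Polynomial.monom 1 (CARD('n) - Suc 0)"
    define R where "R = pcompose K b - Polynomial.monom 1 1 * pcompose S b"
    have R: "ac_eval R z = k - z * t" "ac_eval R (inverse z) = k - inverse z * t"
      by (simp_all add: R_def b_def K S power_pred power_pred_inverse add.commute del: power_inverse)
    note vandermonde_cancel[OF w(1)[unfolded V_split] w(2)[unfolded U_split] z_neq]
      vandermonde_cancel[OF w(3)[unfolded V_split] w(4)[unfolded U_split] z_neq]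
    then show ?thesis
      by (intro exI[of _ "\<lambda>_. R mod g"])
        (simp add: agree_at_def comb xz lessThan_Suc degree_mod ac_eval_mod root self R)
  qed
  have "gen_a ^ i * x \<in> C" for i
  proof -
    obtain k t where kt: "k \<in> adjoin (z + inverse z)" "t \<in> adjoin (z + inverse z)"
      "z ^ i = k - z * t" "inverse z ^ i = k - inverse z * t"
      using poly_split_over_symmetric_subfield[OF root_nonzero, of "Polynomial.monom 1 i"]
      by (metis ac_eval_monom mult_1 to_ac_1)
    show ?thesis
      unfolding C
      by (rule bexI[OF _ kt(1)], rule bexI[OF _ kt(2)])
        (simp add: rot_at_mult[OF unity] rot_at_mult[OF unity_inverse] at_gens[OF unity]
            at_gens[OF unity_inverse] xz V_split U_split flip: kt(3,4) del: power_inverse)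
  qed
  moreover have "W z \<noteq> 0 \<or> W (inverse z) \<noteq> 0"
    using uv(3) WV WU by auto
  ultimately show ?thesis
    using span unfolding local_basis_def
    by (auto simp: agree_at_def comb xz x_at lessThan_Suc rotated_Cons small_poly_eq_0 small_poly_inverse_eq_0)
qed

lemma full_set_self_rotated:
  "full_set_self g = rotated (degree g) [e_elem g, gen_b * e_elem g]"
  by (simp add: full_set_self_def rotated_gen_b)

lemma full_set_cyc_rotated:
  "degree g = 1 \<Longrightarrow> full_set_cyc g = rotated (degree g) [e_elem g, gen_b * e_elem g]"
  by (auto simp: full_set_cyc_def rotated_Cons)

lemma full_set_pair_rotated:
  fixes g :: "'a::field poly"
  shows "(full_set_pair g :: ('n::nontriv, 'a) dihedral_algebra set) = rotated (degree g)
     [e_elem g, gen_b * e_elem g, e_elem (monic_recip g), gen_b * e_elem (monic_recip g)]"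
proof -
  have "rotated d [x, y, x', y'] = rotated d [x, y] \<union> rotated d [x', y']"
    for d and x y x' y' :: "('n, 'a) dihedral_algebra"
    by (auto simp: rotated_Cons)
  then show ?thesis
    by (simp add: full_set_pair_def full_set_self_def rotated_gen_b)
qed

lemma ideal_set_self_rotated:
  "ideal_set_self g F G u v = rotated (degree g)
     [(1 + gen_b) * eval_at F gen_a * eval_at G gen_a
        * (gen_a * eval_at u (gen_a + gen_a_inv) - eval_at v (gen_a + gen_a_inv)) * e_elem g]"
  by (simp add: ideal_set_self_def rotated_Cons mult.assoc)

lemma ideal_set_pair_rotated:
  "ideal_set_pair g u v = rotated (degree g)
     [eval_at u gen_a * e_elem g + gen_b * eval_at v gen_a * e_elem (monic_recip g),
      gen_b * (eval_at u gen_a * e_elem g + gen_b * eval_at v gen_a * e_elem (monic_recip g))]"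
  by (simp add: ideal_set_pair_def rotated_gen_b)

section \<open>Components of the decomposition in terms of values\<close>

lemma mat22_carrier [simp]: "mat22 a b c d \<in> carrier_mat 2 2"
  by (simp add: mat22_def mat_of_rows_list_def numeral_2_eq_2)

lemma mat22_index:
  "mat22 a b c d $$ (0, 0) = a" "mat22 a b c d $$ (0, Suc 0) = b"
  "mat22 a b c d $$ (Suc 0, 0) = c" "mat22 a b c d $$ (Suc 0, Suc 0) = d"
  by (simp_all add: mat22_def mat_of_rows_list_def)

lemma mat22_eqI:
  assumes "Y \<in> carrier_mat 2 2" "Y $$ (0, 0) = a" "Y $$ (0, Suc 0) = b"
    "Y $$ (Suc 0, 0) = c" "Y $$ (Suc 0, Suc 0) = d"
  shows "Y = mat22 a b c d"
  using assms by (intro eq_matI) (auto simp: mat22_index less_2_cases_iff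
      carrier_matD[OF mat22_carrier] carrier_matD[OF assms(1)])

lemma mat22_eq_iff [simp]:
  "mat22 a b c d = mat22 a' b' c' d' \<longleftrightarrow> a = a' \<and> b = b' \<and> c = c' \<and> d = d'"
  by (metis mat22_index)

lemma mat22_mult:
  fixes a :: "'b::comm_ring_1"
  shows "mat22 a b c d * mat22 a' b' c' d'
    = mat22 (a * a' + b * c') (a * b' + b * d') (c * a' + d * c') (c * b' + d * d')"
  by (rule mat22_eqI)
    (auto simp: mat22_index scalar_prod_def carrier_matD[OF mat22_carrier] numeral_2_eq_2
      intro: mult_carrier_mat)

lemma mat22_zero: "0\<^sub>m 2 2 = mat22 0 0 0 0"
  by (rule mat22_eqI) auto

lemma mat22_one: "1\<^sub>m 2 = mat22 1 0 0 (1::'b::comm_ring_1)"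
  by (rule mat22_eqI) auto

lemma elements_mat22: "elements_mat (mat22 a b c d) = {a, b, c, d}"
  by (auto simp: elements_mat_def carrier_matD[OF mat22_carrier] mat22_index numeral_2_eq_2)

text \<open>
  Clearing \<open>Z\<^sup>-\<^sup>1\<close> avoids any further mention of the inverse; \<open>Z\<close> is invertible because its
  determinant is \<open>z - 1/z\<close>.
\<close>

lemma sigma_eq_iff:
  assumes z: "z \<noteq> 0" "z \<noteq> inverse z" and Y: "Y \<in> carrier_mat 2 2" and Y': "Y' \<in> carrier_mat 2 2"
  shows "sigma z Y = Y' \<longleftrightarrow> Y * mat22 1 (- z) 1 (- inverse z) = mat22 1 (- z) 1 (- inverse z) * Y'"
proof -
  define Z where "Z = mat22 1 (- z) 1 (- inverse z)"
  define D where "D = inverse (z - inverse z)"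
  define Z' where "Z' = mat22 (- inverse z * D) (z * D) (- D) D"
  have ZC: "Z \<in> carrier_mat 2 2" "Z' \<in> carrier_mat 2 2" by (simp_all add: Z_def Z'_def)
  have "D * (z - inverse z) = 1" using z by (simp add: D_def)
  then have D: "1 + D * inverse z = D * z" by (simp add: algebra_simps)
  have "Z * Z' = 1\<^sub>m 2" "Z' * Z = 1\<^sub>m 2"
    using D by (simp_all add: Z_def Z'_def mat22_mult mat22_one algebra_simps)
  then have "Z \<in> Units (ring_mat TYPE('a alg_closure) 2 ())"
    using ZC unfolding Units_def ring_mat_def by auto
  then obtain Zi where Zi: "mat_inverse Z = Some Zi"
    using mat_inverse(1)[OF ZC(1), where b = "()"] by (cases "mat_inverse Z") auto
  from mat_inverse(2)[OF ZC(1) Zi] have inv: "Z * Zi = 1\<^sub>m 2" "Zi * Z = 1\<^sub>m 2" "Zi \<in> carrier_mat 2 2"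
    by auto
  have s: "sigma z Y = Zi * (Y * Z)"
    using Zi inv(3) Y ZC by (simp add: sigma_def Let_def Z_def[symmetric] assoc_mult_mat[of _ 2 2 _ 2 _ 2])
  have "Y * Z = Z * Y'" if "sigma z Y = Y'"
  proof -
    have "Z * Y' = (Z * Zi) * (Y * Z)"
      using that s inv(3) Y ZC by (simp add: assoc_mult_mat[of _ 2 2 _ 2 _ 2])
    then show ?thesis using inv Y ZC by simp
  qed
  moreover have "sigma z Y = Y'" if "Y * Z = Z * Y'"
  proof -
    have "sigma z Y = (Zi * Z) * Y'"
      using that s inv(3) Y' ZC by (simp add: assoc_mult_mat[of _ 2 2 _ 2 _ 2])
    then show ?thesis using inv Y' by simp
  qed
  ultimately show ?thesis unfolding Z_def by blast
qed

lemma tau_altdef: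
  "tau z w = mat22 (rot_at z w) (ref_at (inverse z) w) (ref_at z w) (rot_at (inverse z) w)"
  by (simp add: tau_def rot_at_def ref_at_def)

lemma sigma_tau_eq_iff:
  assumes "z \<noteq> 0" "z \<noteq> inverse z"
  shows "sigma z (tau z w) = mat22 a b c d \<longleftrightarrow>
    rot_at z w + ref_at (inverse z) w = a - z * c \<and>
    z * rot_at z w + inverse z * ref_at (inverse z) w = - (b - z * d) \<and>
    ref_at z w + rot_at (inverse z) w = a - inverse z * c \<and>
    z * ref_at z w + inverse z * rot_at (inverse z) w = - (b - inverse z * d)"
proof -
  have *: "- p - q = r \<longleftrightarrow> p + q = - r" for p q r :: "'a alg_closure"
    by (metis add.inverse_inverse minus_add_distrib diff_conv_add_uminus)
  show ?thesis
    by (subst sigma_eq_iff[OF assms])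
      (auto simp: tau_altdef mat22_mult * mult.commute)
qed

text \<open>
  The columns of \<open>\<tau>(w) Z\<close> have the form \<open>(R(z), R(1/z))\<close> with \<open>R = P + Q(1/x)\<close> for the first column
  and \<open>R = -(x P + Q(1/x)/x)\<close> for the second one, where \<open>1/x\<close> is replaced by \<open>x\<^bsup>n-1\<^esup>\<close>.  So
  conjugation by \<open>Z\<close> takes the image of the group algebra into the matrices over \<open>K[z + 1/z]\<close>, where \<open>K\<close> is the ground field.
\<close>

lemma sigma_tau_coordinates:
  fixes w :: "('n::nontriv, 'a::field) dihedral_algebra"
  assumes z: "z ^ CARD('n) = 1" and z_neq: "z \<noteq> inverse z"
  obtains a b c d where "{a, b, c, d} \<subseteq> adjoin (z + inverse z)" "sigma z (tau z w) = mat22 a b c d"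
proof -
  have z0: "z \<noteq> 0" using z_neq by auto
  note pred_z = root_of_unity_power_pred[OF z] root_of_unity_power_pred[OF root_of_unity_inverse[OF z]]
  \<comment> \<open>A polynomial that represents \<open>1/x\<close> at all \<open>n\<close>-th roots of unity.\<close>
  define inv_x where "inv_x = Polynomial.monom (1 :: 'a) (CARD('n) - Suc 0)"
  let ?Q = "pcompose (Q_part w) inv_x"
  obtain a c where ac: "a \<in> adjoin (z + inverse z)" "c \<in> adjoin (z + inverse z)"
    "ac_eval (P_part w + ?Q) z = a - z * c" "ac_eval (P_part w + ?Q) (inverse z) = a - inverse z * c"
    using poly_split_over_symmetric_subfield[OF z0] by blast
  obtain b d where bd: "b \<in> adjoin (z + inverse z)" "d \<in> adjoin (z + inverse z)"
    "ac_eval (Polynomial.monom 1 1 * P_part w + inv_x * ?Q) z = b - z * d"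
    "ac_eval (Polynomial.monom 1 1 * P_part w + inv_x * ?Q) (inverse z) = b - inverse z * d"
    using poly_split_over_symmetric_subfield[OF z0] by blast
  have "sigma z (tau z w) = mat22 a (- b) c (- d)"
    using ac(3,4) bd(3,4)
    by (subst sigma_tau_eq_iff[OF z0 z_neq])
      (simp add: rot_at_def ref_at_def inv_x_def pred_z add.commute del: power_inverse)
  then show ?thesis
    using that[of a "- b" c "- d"] ac(1,2) bd(1,2) by (simp add: adjoin_uminus)
qed

lemma tau_eq_iff: "tau z w = tau z w' \<longleftrightarrow> agree_at z w w'"
  by (auto simp: tau_altdef agree_at_def)

lemma sigma_tau_eq_sigma_tau_iff:
  fixes w w' :: "('n::nontriv, 'a::field) dihedral_algebra"
  assumes z: "z ^ CARD('n) = 1" and z_neq: "z \<noteq> inverse z"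
  shows "sigma z (tau z w) = sigma z (tau z w') \<longleftrightarrow> agree_at z w w'"
proof
  have z0: "z \<noteq> 0" using z_neq by auto
  assume eq: "sigma z (tau z w) = sigma z (tau z w')"
  obtain a b c d where "sigma z (tau z w) = mat22 a b c d" "sigma z (tau z w') = mat22 a b c d"
    using sigma_tau_coordinates[OF z z_neq, of w] eq by metis
  then have *: "rot_at z w + ref_at (inverse z) w = rot_at z w' + ref_at (inverse z) w'"
    "z * rot_at z w + inverse z * ref_at (inverse z) w = z * rot_at z w' + inverse z * ref_at (inverse z) w'"
    "ref_at z w + rot_at (inverse z) w = ref_at z w' + rot_at (inverse z) w'"
    "z * ref_at z w + inverse z * rot_at (inverse z) w = z * ref_at z w' + inverse z * rot_at (inverse z) w'"
    unfolding sigma_tau_eq_iff[OF z0 z_neq] by simp_all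
  show "agree_at z w w'"
    using vandermonde_cancel[OF *(1,2) z_neq] vandermonde_cancel[OF *(3,4) z_neq]
    by (simp add: agree_at_def)
next
  assume "agree_at z w w'"
  then show "sigma z (tau z w) = sigma z (tau z w')"
    by (simp add: tau_eq_iff[symmetric])
qed

lemma cyc_elem_eq_iff [simp]: "cyc_elem a b = cyc_elem a' b' \<longleftrightarrow> a = a' \<and> b = b'"
proof
  assume *: "cyc_elem a b = cyc_elem a' b'"
  have "Poly_Mapping.lookup (cyc_elem a b) 0 = a" "Poly_Mapping.lookup (cyc_elem a b) 1 = b" for a b :: "'a alg_closure"
    by (simp_all add: cyc_elem_def lookup_add lookup_single when_def)
  then show "a = a' \<and> b = b'" using * by metis
qed simp

lemma cyc_elem_mult: "cyc_elem a b * cyc_elem c d = cyc_elem (a * c + b * d) (a * d + b * c)"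
  by (simp add: cyc_elem_def algebra_simps mult_single single_add)

lemma cyc_algebra_altdef: "cyc_algebra = {cyc_elem (to_ac a) (to_ac b) | a b. True}"
proof (intro equalityI subsetI)
  fix w :: "bit \<Rightarrow>\<^sub>0 'a alg_closure"
  assume "w \<in> cyc_algebra"
  then obtain a b where "Poly_Mapping.lookup w 0 = to_ac a" "Poly_Mapping.lookup w 1 = to_ac b"
    unfolding cyc_algebra_def by blast
  then have "Poly_Mapping.lookup w k = Poly_Mapping.lookup (cyc_elem (to_ac a) (to_ac b)) k" for k
    by (cases k) (simp_all add: cyc_elem_def lookup_add lookup_single when_def)
  then have "w = cyc_elem (to_ac a) (to_ac b)" by (rule poly_mapping_eqI)
  then show "w \<in> {cyc_elem (to_ac a) (to_ac b) | a b. True}" by blast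
next
  fix w :: "bit \<Rightarrow>\<^sub>0 'a alg_closure"
  assume "w \<in> {cyc_elem (to_ac a) (to_ac b) | a b. True}"
  then show "w \<in> cyc_algebra"
    by (auto simp: cyc_algebra_def cyc_elem_def lookup_add lookup_single when_def
        simp flip: to_ac_add)
qed

lemma cyc_map_altdef: "cyc_map c w = cyc_elem (rot_at (to_ac c) w) (ref_at (to_ac c) w)"
  by (simp add: cyc_map_def rot_at_def ref_at_def ac_eval_to_ac)

lemma cyc_map_eq_iff:
  assumes "inverse (to_ac c) = to_ac c"
  shows "cyc_map c w = cyc_map c w' \<longleftrightarrow> agree_at (to_ac c) w w'"
  by (auto simp: cyc_map_altdef agree_at_def assms simp del: to_ac_inverse)

text \<open>
  In the group algebra of order two, \<open>(c + d h) (1 + s h) = (c + s d) (1 + s h)\<close> for \<open>s = \<plusminus>1\<close>.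
\<close>

lemma cyc_map_in_ideal_iff:
  fixes s :: "'a::field alg_closure"
  assumes "s = 1 \<or> s = - 1"
  shows "cyc_map c w \<in> {y * cyc_elem 1 s | y. y \<in> cyc_algebra} \<longleftrightarrow>
    ref_at (to_ac c) w = s * rot_at (to_ac c) w"
proof
  assume "cyc_map c w \<in> {y * cyc_elem 1 s | y. y \<in> cyc_algebra}"
  then obtain a b where "cyc_map c w = cyc_elem (to_ac a) (to_ac b) * cyc_elem 1 s"
    unfolding cyc_algebra_altdef by auto
  then show "ref_at (to_ac c) w = s * rot_at (to_ac c) w"
    using assms by (auto simp: cyc_map_altdef cyc_elem_mult)
next
  assume "ref_at (to_ac c) w = s * rot_at (to_ac c) w"
  then have "cyc_map c w = cyc_elem (to_ac (poly (P_part w) c)) (to_ac 0) * cyc_elem 1 s"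
    by (simp add: cyc_map_altdef cyc_elem_mult rot_at_def ac_eval_to_ac mult.commute)
  then show "cyc_map c w \<in> {y * cyc_elem 1 s | y. y \<in> cyc_algebra}"
    unfolding cyc_algebra_altdef by blast
qed

section \<open>Bases and generating matrices of dihedral codes\<close>

theorem theorem6:
  fixes f F1 F2 G1 G2 u v :: "nat \<Rightarrow> 'a::{field,finite} poly"
    and \<alpha> x :: "nat \<Rightarrow> 'a alg_closure"
    and r s :: nat
    and J1 J2 J3 J4 :: "nat set"
    and I :: "('n::nontriv, 'a) dihedral_algebra set"
    and B :: "nat \<Rightarrow> 'a component set"
    and T :: "('n, 'a) dihedral_algebra set"
  assumes coprime: "coprime CARD('a) CARD('n)"
    and factorization:
      "Polynomial.monom 1 CARD('n) - 1
         = (\<Prod>j=1..r. f j) * (\<Prod>j=r+1..r+s. f j * monic_recip (f j))"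
    and factors: "\<And>j. j \<in> {1..r+s} \<Longrightarrow> lead_coeff (f j) = 1 \<and> irreducible (f j)"
    and distinct_factors:
      "distinct (map f [1..<r+s+1] @ map (\<lambda>j. monic_recip (f j)) [r+1..<r+s+1])"
    and r_ge: "zeta CARD('n) \<le> r"
    and f_1: "f 1 = [:- 1, 1:]"
    and f_2: "even CARD('n) \<Longrightarrow> f 2 = [:1, 1:]"
    and self_recip: "\<And>j. 1 < j \<Longrightarrow> j \<le> r \<Longrightarrow> reflect_poly (f j) = f j"
    and not_self_recip: "\<And>j. j \<in> {r+1..r+s} \<Longrightarrow>
      {z. ac_eval (f j) z = 0} \<inter> {z. ac_eval (monic_recip (f j)) z = 0} = {}"
    and roots: "\<And>j. j \<in> {1..r+s} \<Longrightarrow> ac_eval (f j) (\<alpha> j) = 0"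
    and bezout_F: "\<And>j. j \<in> {zeta CARD('n) + 1..r} \<Longrightarrow> [:- 1, 1:] * F1 j + f j * F2 j = 1"
    and bezout_G: "\<And>j. j \<in> {zeta CARD('n) + 1..r} \<Longrightarrow> [:1, 1:] * G1 j + f j * G2 j = 1"
    and code: "left_ideal I"
    and J_subset: "J1 \<subseteq> {1..r+s}" "J2 \<subseteq> {1..r+s}" "J3 \<subseteq> {1..r+s}"
      "J4 \<subseteq> {zeta CARD('n) + 1..r+s}"
    and J_disjoint: "J1 \<inter> J2 = {}" "J1 \<inter> J3 = {}" "J1 \<inter> J4 = {}"
      "J2 \<inter> J3 = {}" "J2 \<inter> J4 = {}" "J3 \<inter> J4 = {}"
    and q_even: "even CARD('a) \<Longrightarrow> 1 \<notin> J2"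
    and x_J4: "\<And>j. j \<in> J4 \<Longrightarrow> x j \<in> comp_field CARD('n) r \<alpha> j \<and> x j \<noteq> 0"
    and B_def: "\<And>j. B j =
      (if j \<in> J1 then comp_algebra CARD('n) r \<alpha> j
       else if j \<in> J2 then comp_ideal CARD('n) r \<alpha> j 0 1
       else if j \<in> J3 then comp_ideal CARD('n) r \<alpha> j 1 0
       else if j \<in> J4 then comp_ideal CARD('n) r \<alpha> j (- x j) 1
       else comp_zero CARD('n) j)"
    and image: "full_map r s \<alpha> ` I = (\<Pi>\<^sub>E j\<in>{1..r+s}. B j)"
    and uv_self: "\<And>j. j \<in> {zeta CARD('n) + 1..r} \<Longrightarrow> j \<in> J2 \<union> J3 \<union> J4 \<Longrightarrow>
      (ac_eval (u j) (\<alpha> j + inverse (\<alpha> j)), ac_eval (v j) (\<alpha> j + inverse (\<alpha> j)))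
        = (if j \<in> J2 then (0, 1) else if j \<in> J3 then (1, 0) else (- x j, 1))"
    and uv_pair_J2: "\<And>j. j \<in> {r+1..r+s} \<Longrightarrow> j \<in> J2 \<Longrightarrow> u j = 1 \<and> v j = 0"
    and uv_pair_J3: "\<And>j. j \<in> {r+1..r+s} \<Longrightarrow> j \<in> J3 \<Longrightarrow> u j = 0 \<and> v j = 1"
    and uv_pair_J4: "\<And>j. j \<in> {r+1..r+s} \<Longrightarrow> j \<in> J4 \<Longrightarrow>
      u j = 1 \<and> ac_eval (v j) (inverse (\<alpha> j)) = x j"
    and T_def: "T = (\<Union>j\<in>{1..r+s}. basis_set r f F1 G1 J1 J2 J3 J4 u v j)"
  shows "is_basis T I \<and>
    (\<forall>M. (\<forall>j\<in>J1 \<union> J2 \<union> J3 \<union> J4.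
             is_rows_matrix_of_set (M j)
               (basis_set r f F1 G1 J1 J2 J3 J4 u v j :: ('n, 'a) dihedral_algebra set)) \<longrightarrow>
         is_generating_matrix
           (stack_rows (2 * CARD('n)) (map M (sorted_list_of_set (J1 \<union> J2 \<union> J3 \<union> J4)))) I)"
proof -
  let ?n = "CARD('n)" and ?J = "{1..r+s}"
  let ?S = "\<lambda>j. basis_set r f F1 G1 J1 J2 J3 J4 u v j :: ('n, 'a) dihedral_algebra set"
  let ?comp = "\<lambda>j w. comp_map r \<alpha> j (w :: ('n, 'a) dihedral_algebra)"
  note f_1' = f_1[unfolded One_nat_def]
  have zeta: "1 \<le> zeta ?n" "zeta ?n \<le> r" "even ?n \<Longrightarrow> zeta ?n = 2" "odd ?n \<Longrightarrow> zeta ?n = 1"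
    using r_ge by (auto simp: zeta_def)
  have f_dvd: "f j dvd Polynomial.monom 1 ?n - 1" if "j \<in> ?J" for j
  proof (cases "j \<le> r")
    case True
    then have "f j dvd (\<Prod>j=1..r. f j)" using that by (intro dvd_prodI) auto
    then show ?thesis unfolding factorization by simp
  next
    case False
    then have "f j * monic_recip (f j) dvd (\<Prod>j=r+1..r+s. f j * monic_recip (f j))"
      using that by (intro dvd_prodI) auto
    then show ?thesis unfolding factorization by (meson dvd_mult dvd_mult_left)
  qed
  have uf: "unity_factor ?n (f j) (\<alpha> j)" if "j \<in> ?J" for j
    using f_dvd factors roots of_nat_nonzero_coprime[OF coprime] that by unfold_locales auto
  note unity = unity_factor.unity[OF uf] and root_nonzero = unity_factor.root_nonzero[OF uf]
  have f_inj: "inj_on f (set [1..<r+s+1])"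
    and f_recip_disjoint: "set (map f [1..<r+s+1]) \<inter> set (map (\<lambda>j. monic_recip (f j)) [r+1..<r+s+1]) = {}"
    using distinct_factors unfolding distinct_append distinct_map by blast+
  have f_neq: "f j \<noteq> f j'" if "j \<in> ?J" "j' \<in> ?J" "j \<noteq> j'" for j j'
  proof -
    have "j \<in> set [1..<r+s+1]" "j' \<in> set [1..<r+s+1]" using that by auto
    then show ?thesis using inj_onD[OF f_inj] that(3) by blast
  qed
  have f_neq_recip: "f j \<noteq> monic_recip (f j')" if "j \<in> ?J" "j' \<in> {r+1..r+s}" for j j'
  proof -
    have "j \<in> set [1..<r+s+1]" "j' \<in> set [r+1..<r+s+1]" using that by auto
    then have "f j \<in> set (map f [1..<r+s+1])"
      "monic_recip (f j') \<in> set (map (\<lambda>j. monic_recip (f j)) [r+1..<r+s+1])"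
      unfolding set_map by blast+
    then show ?thesis using f_recip_disjoint by (metis disjoint_iff)
  qed
  \<comment> \<open>The polynomial \<open>f 1 = x - 1\<close> equals its reciprocal only up to sign, hence the case distinction.\<close>
  have reciprocal: "ac_eval (f j) (inverse y) = 0 \<longleftrightarrow> ac_eval (f j) y = 0"
    if "j \<in> ?J" "j \<le> r" "y \<noteq> 0" for j y
  proof (cases "j = 1")
    case True
    then show ?thesis using that by (auto simp: f_1')
  next
    case False
    then show ?thesis using self_recip[of j] ac_eval_reflect_poly[of y "f j"] that by simp
  qed
  have self: "ac_eval (f j) (inverse (\<alpha> j)) = 0" if "j \<in> ?J" "j \<le> r" for j
    using reciprocal[OF that root_nonzero[OF that(1)]] roots[OF that(1)] by simp
  have pair: "ac_eval (f j) (inverse (\<alpha> j)) \<noteq> 0" if "j \<in> {r+1..r+s}" for j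
    using not_self_recip[OF that] that roots[of j] root_nonzero[of j]
    by (auto simp: ac_eval_monic_recip_eq_0_iff)
  \<comment> \<open>Distinct monic primes have no common root, and the roots of the reciprocal of a factor are the
    inverses of its roots.\<close>
  have separate: "ac_eval (f j) (\<alpha> j') \<noteq> 0 \<and> ac_eval (f j) (inverse (\<alpha> j')) \<noteq> 0"
    if j: "j \<in> ?J" "j' \<in> ?J" "j \<noteq> j'" for j j'
  proof -
    have 1: "ac_eval (f j) (\<alpha> j') \<noteq> 0"
    proof
      assume "ac_eval (f j) (\<alpha> j') = 0"
      then have "f j' dvd f j" by (simp add: unity_factor.dvd_iff[OF uf[OF j(2)]])
      then have "f j' = f j"
        using unity_factor.prime[OF uf] factors j by (intro monic_prime_dvd_eq) auto
      then show False using f_neq[OF j] by simp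
    qed
    have "ac_eval (f j) (inverse (\<alpha> j')) \<noteq> 0"
    proof (cases "j \<le> r")
      case True
      then show ?thesis using 1 reciprocal[OF j(1) _ root_nonzero[OF j(2)]] by simp
    next
      case False
      show ?thesis
      proof
        assume "ac_eval (f j) (inverse (\<alpha> j')) = 0"
        then have "f j' dvd monic_recip (f j)"
          using root_nonzero[OF j(2)]
          by (simp add: unity_factor.dvd_iff[OF uf[OF j(2)]] ac_eval_monic_recip_eq_0_iff)
        then have "f j' = monic_recip (f j)"
          using unity_factor.prime[OF uf[OF j(2)]] unity_factor.recip_prime[OF uf[OF j(1)]]
            unity_factor.lead_coeff_recip[OF uf[OF j(1)]] factors[OF j(2)]
          by (intro monic_prime_dvd_eq) auto
        then show False using f_neq_recip[of j' j] j False by auto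
      qed
    qed
    with 1 show ?thesis by simp
  qed
  have \<alpha>_1: "\<alpha> (Suc 0) = to_ac 1"
    using roots[of 1] zeta by (simp add: f_1')
  have \<alpha>_2: "\<alpha> 2 = to_ac (- 1)" if "even ?n"
  proof -
    have "1 + \<alpha> 2 = 0" using roots[of 2] zeta that by (simp add: f_2)
    then show ?thesis by (simp add: add_eq_0_iff)
  qed
  \<comment> \<open>The fixed points of inversion are \<open>1\<close>, the root of \<open>f 1\<close>, and \<open>-1\<close>, which is the root of \<open>f 2\<close> if
    \<open>n\<close> is even; for odd \<open>n\<close>, \<open>-1\<close> is an \<open>n\<close>-th root of unity only in characteristic two.\<close>
  have z_neq: "\<alpha> j \<noteq> inverse (\<alpha> j)" if j: "j \<in> {zeta ?n + 1..r + s}" for j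
  proof
    assume "\<alpha> j = inverse (\<alpha> j)"
    then have "(\<alpha> j - 1) * (\<alpha> j + 1) = 0"
      using root_nonzero[of j] j by (simp add: field_simps)
    then consider "\<alpha> j = 1" | "\<alpha> j = - 1" by (auto simp: add_eq_0_iff2)
    then show False
    proof cases
      case 1
      then show ?thesis using separate[of 1 j] j zeta by (simp add: f_1')
    next
      case 2
      show ?thesis
      proof (cases "even ?n")
        case True
        then show ?thesis using separate[of 2 j] 2 j zeta(2,3) by (simp add: f_2)
      next
        case False
        then have "(- 1 :: 'a alg_closure) = 1" using unity[of j] 2 j by simp
        then show ?thesis using separate[of 1 j] 2 j zeta by (simp add: f_1')
      qed
    qed
  qed
  have factor_all_dvd: "Polynomial.monom 1 ?n - 1 dvd p"
    if p: "\<And>j. j \<in> ?J \<Longrightarrow> ac_eval p (\<alpha> j) = 0 \<and> ac_eval p (inverse (\<alpha> j)) = 0" for p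
  proof -
    let ?fs = "map f [1..<r+s+1] @ map (\<lambda>j. monic_recip (f j)) [r+1..<r+s+1]"
    have "(\<Prod>j=1..r. f j) * (\<Prod>j=r+1..r+s. f j * monic_recip (f j))
        = (\<Prod>j=1..r+s. f j) * (\<Prod>j=r+1..r+s. monic_recip (f j))"
    proof -
      have "{1..r+s} = {1..r} \<union> {r+1..r+s}" by auto
      then have "(\<Prod>j=1..r+s. f j) = (\<Prod>j=1..r. f j) * (\<Prod>j=r+1..r+s. f j)"
        by (simp add: prod.union_disjoint)
      then show ?thesis by (simp add: prod.distrib mult.assoc)
    qed
    also have "\<dots> = prod_list ?fs"
    proof -
      have "prod h {i..k} = prod_list (map h [i..<k+1])" for h :: "nat \<Rightarrow> 'a poly" and i k
        using prod.distinct_set_conv_list[of "[i..<k+1]" h]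
        by (simp add: atLeastLessThanSuc_atLeastAtMost del: upt_Suc)
      then show ?thesis by (simp only: prod_list.append)
    qed
    also have "\<dots> = \<Prod>(set ?fs)"
      using prod.distinct_set_conv_list[OF distinct_factors, of "\<lambda>h. h"] by (simp only: list.map_ident)
    finally have "Polynomial.monom 1 ?n - 1 = \<Prod>(set ?fs)" using factorization by simp
    moreover have "\<Prod>(set ?fs) dvd p"
    proof (rule prod_monic_primes_dvd)
      fix h assume "h \<in> set ?fs"
      then have "h \<in> f ` ?J \<union> (\<lambda>j. monic_recip (f j)) ` ?J"
        by (auto simp: less_Suc_eq_le simp del: upt_Suc)
      then obtain j where j: "j \<in> ?J" "h = f j \<or> h = monic_recip (f j)" by blast
      then show "prime_elem h \<and> lead_coeff h = 1 \<and> h dvd p"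
        using unity_factor.prime[OF uf[OF j(1)]] unity_factor.recip_prime[OF uf[OF j(1)]]
          unity_factor.lead_coeff_recip[OF uf[OF j(1)]] factors[OF j(1)] p[OF j(1)]
          unity_factor.dvd_iff[OF uf[OF j(1)]] unity_factor.recip_dvd_iff[OF uf[OF j(1)]]
        by metis
    qed simp
    ultimately show ?thesis by simp
  qed
  have faithful: "w = w'" if agree: "\<And>j. j \<in> ?J \<Longrightarrow> agree_at (\<alpha> j) w w'"
    for w w' :: "('n, 'a) dihedral_algebra"
  proof -
    have small: "p = 0" if "Polynomial.monom 1 ?n - 1 dvd p" "degree p < ?n" for p :: "'a poly"
    proof (rule ccontr)
      assume "p \<noteq> 0"
      then have "degree (Polynomial.monom (1 :: 'a) ?n - 1) \<le> degree p"
        using that by (intro dvd_imp_degree_le)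
      then show False
        using that(2) degree_add_eq_left[of "- 1" "Polynomial.monom (1 :: 'a) ?n"]
        by (simp add: degree_monom_eq)
    qed
    have "rot_at (\<alpha> j) (w - w') = 0 \<and> rot_at (inverse (\<alpha> j)) (w - w') = 0"
      "ref_at (\<alpha> j) (w - w') = 0 \<and> ref_at (inverse (\<alpha> j)) (w - w') = 0" if "j \<in> ?J" for j
      using agree[OF that] by (simp_all add: agree_at_def)
    then have "P_part (w - w') = 0" "Q_part (w - w') = 0"
      by (intro small factor_all_dvd degree_P_Q_part; simp add: rot_at_def ref_at_def)+
    then have "w - w' = 0" by (rule P_Q_part_eq_0D)
    then show ?thesis by simp
  qed
  have cyc: "\<exists>c. (c = 1 \<or> c = - 1) \<and> \<alpha> j = to_ac c \<and> degree (f j) = 1 \<and> ?comp j = (\<lambda>w. Inl (cyc_map c w))"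
    if "j \<in> ?J" "j \<le> zeta ?n" for j
  proof (cases "j = 1")
    case True
    then show ?thesis
      by (intro exI[of _ 1]) (simp add: \<alpha>_1 f_1' comp_map_def fun_eq_iff)
  next
    case False
    then have "even ?n" "j = 2" using that zeta by (cases "even ?n"; auto)+
    then show ?thesis
      by (intro exI[of _ "- 1"]) (simp add: \<alpha>_2 f_2 comp_map_def fun_eq_iff zeta_def)
  qed
  have comp_self: "?comp j = (\<lambda>w. Inr (sigma (\<alpha> j) (tau (\<alpha> j) w)))"
    if "j \<in> {zeta ?n + 1..r}" for j
    using that zeta by (auto simp: comp_map_def)
  have comp_pair: "?comp j = (\<lambda>w. Inr (tau (\<alpha> j) w))" if "j \<in> {r+1..r+s}" for j
    using that zeta by (auto simp: comp_map_def)
  have cases: "(\<And>c. c = 1 \<or> c = - 1 \<Longrightarrow> \<alpha> j = to_ac c \<Longrightarrow> degree (f j) = 1 \<Longrightarrow>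
        ?comp j = (\<lambda>w. Inl (cyc_map c w)) \<Longrightarrow> j \<le> zeta ?n \<Longrightarrow> R) \<Longrightarrow>
      (j \<in> {zeta ?n + 1..r} \<Longrightarrow> R) \<Longrightarrow> (j \<in> {r+1..r+s} \<Longrightarrow> R) \<Longrightarrow> R"
    if "j \<in> ?J" for j R
    using cyc[OF that] that by (cases "j \<le> zeta ?n"; cases "j \<le> r") auto
  \<comment> \<open>Each component of the decomposition carries exactly the values of \<open>\<tau>\<close> at \<open>\<alpha> j\<close>, so the whole
    decomposition is injective.\<close>
  have comp_eq_iff: "?comp j w = ?comp j w' \<longleftrightarrow> agree_at (\<alpha> j) w w'" if j: "j \<in> ?J" for j w w'
  proof (rule cases[OF j])
    show ?thesis if "c = 1 \<or> c = - 1" "\<alpha> j = to_ac c" "?comp j = (\<lambda>w. Inl (cyc_map c w))" for c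
    proof -
      have "inverse (to_ac c) = to_ac c" using that(1) by auto
      then show ?thesis using cyc_map_eq_iff[of c w w'] that by simp
    qed
    show ?thesis if "j \<in> {zeta ?n + 1..r}"
      using sigma_tau_eq_sigma_tau_iff[OF unity[OF j] z_neq] that comp_self[OF that] by simp
    show ?thesis if "j \<in> {r+1..r+s}"
      by (simp add: comp_pair[OF that] tau_eq_iff)
  qed
  define C where "C j = {w. ?comp j w \<in> B j}" for j
  \<comment> \<open>By injectivity, the code is the full preimage of its image.\<close>
  have I_eq: "I = {w. \<forall>j\<in>?J. w \<in> C j}"
  proof (intro equalityI subsetI CollectI ballI)
    fix w j assume "w \<in> I" "j \<in> ?J"
    then have "full_map r s \<alpha> w \<in> (\<Pi>\<^sub>E j\<in>?J. B j)" using image by blast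
    then show "w \<in> C j" using \<open>j \<in> ?J\<close> by (auto simp: C_def full_map_def dest: PiE_mem)
  next
    fix w assume "w \<in> {w. \<forall>j\<in>?J. w \<in> C j}"
    then have "full_map r s \<alpha> w \<in> (\<Pi>\<^sub>E j\<in>?J. B j)"
      by (auto simp: C_def full_map_def)
    then obtain w' where w': "w' \<in> I" "full_map r s \<alpha> w = full_map r s \<alpha> w'"
      unfolding image[symmetric] by blast
    have "agree_at (\<alpha> j) w w'" if "j \<in> ?J" for j
      using fun_cong[OF w'(2), of j] that comp_eq_iff[OF that] by (simp add: full_map_def)
    then show "w \<in> I" using faithful w'(1) by metis
  qed
  have J_sub: "J1 \<union> J2 \<union> J3 \<union> J4 \<subseteq> ?J" using J_subset by auto
  have local_zero: "\<exists>xs. ?S j = rotated (degree (f j)) xs \<and> local_basis (f j) (\<alpha> j) (C j) xs"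
    if j: "j \<in> ?J" "j \<notin> J1 \<union> J2 \<union> J3 \<union> J4" for j
  proof -
    have 0: "?comp j 0 \<in> comp_zero ?n j"
    proof (rule cases[OF j(1)])
      show "?comp j 0 \<in> comp_zero ?n j"
        if "?comp j = (\<lambda>w. Inl (cyc_map c w))" "j \<le> zeta ?n" for c
        using that by (simp add: comp_zero_def cyc_map_altdef cyc_elem_def)
      show "?comp j 0 \<in> comp_zero ?n j" if *: "j \<in> {zeta ?n + 1..r}"
      proof -
        have "sigma (\<alpha> j) (tau (\<alpha> j) (0 :: ('n, 'a) dihedral_algebra)) = mat22 0 0 0 0"
          using root_nonzero[OF j(1)] z_neq[of j] * by (subst sigma_tau_eq_iff) auto
        then show ?thesis using * by (simp add: comp_zero_def comp_self mat22_zero)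
      qed
      show "?comp j 0 \<in> comp_zero ?n j" if "j \<in> {r+1..r+s}"
        using that zeta by (simp add: comp_zero_def comp_pair mat22_zero tau_altdef)
    qed
    obtain y where y: "comp_zero ?n j = {y :: 'a component}"
      by (cases "j \<le> zeta ?n") (auto simp: comp_zero_def)
    have "?comp j w = ?comp j 0" if "w \<in> C j" for w
    proof -
      have "?comp j w \<in> comp_zero ?n j" using that j(2) by (simp add: C_def B_def)
      then show ?thesis using 0 unfolding y by simp
    qed
    then have "agree_at (\<alpha> j) 0 w" if "w \<in> C j" for w
      using that comp_eq_iff[OF j(1), of 0 w] by simp
    then have "local_basis (f j) (\<alpha> j) (C j) []" by (rule local_basis_zero)
    then show ?thesis using j(2) by (intro exI[of _ "[]"]) (auto simp: basis_set_def)
  qed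
  have local_full: "\<exists>xs. ?S j = rotated (degree (f j)) xs \<and> local_basis (f j) (\<alpha> j) (C j) xs"
    if j: "j \<in> J1" for j
  proof -
    have jJ: "j \<in> ?J" using j J_subset by blast
    have C: "w \<in> C j \<longleftrightarrow> ?comp j w \<in> comp_algebra ?n r \<alpha> j" for w
      using j by (simp add: C_def B_def)
    show ?thesis
    proof (rule cases[OF jJ])
      fix c assume *: "?comp j = (\<lambda>w. Inl (cyc_map c w))" "j \<le> zeta ?n" "degree (f j) = 1"
      have "w \<in> C j" for w
        unfolding C using * by (auto simp: comp_algebra_def cyc_map_def cyc_algebra_altdef)
      moreover have "j \<le> r" using * zeta by simp
      ultimately have "local_basis (f j) (\<alpha> j) (C j) [e_elem (f j), gen_b * e_elem (f j)]"
        using self[OF jJ] by (intro local_basis_full_self uf[OF jJ])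
      then show ?thesis using * j
        by (intro exI[of _ "[e_elem (f j), gen_b * e_elem (f j)]"])
          (simp add: basis_set_def full_set_cyc_rotated)
    next
      assume *: "j \<in> {zeta ?n + 1..r}"
      have "w \<in> C j" for w
      proof -
        obtain a b c d where "{a, b, c, d} \<subseteq> adjoin (\<alpha> j + inverse (\<alpha> j))"
            "sigma (\<alpha> j) (tau (\<alpha> j) w) = mat22 a b c d"
          by (rule sigma_tau_coordinates[OF unity[OF jJ], of w]) (use z_neq[of j] * in auto)
        then show ?thesis
          unfolding C using * by (auto simp: comp_self comp_algebra_def comp_field_def elements_mat22)
      qed
      then have "local_basis (f j) (\<alpha> j) (C j) [e_elem (f j), gen_b * e_elem (f j)]"
        using self[OF jJ] * by (intro local_basis_full_self uf[OF jJ]) auto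
      then show ?thesis using * j
        by (intro exI[of _ "[e_elem (f j), gen_b * e_elem (f j)]"])
          (simp add: basis_set_def full_set_self_rotated)
    next
      assume *: "j \<in> {r+1..r+s}"
      have "w \<in> C j" for w
        unfolding C using * zeta ac_eval_in_adjoin[of _ "\<alpha> j"]
          unity_factor.ac_eval_inverse_in_adjoin[OF uf[OF jJ]]
        by (auto simp: comp_pair comp_algebra_def comp_field_def elements_mat22 tau_def)
      then have "local_basis (f j) (\<alpha> j) (C j) [e_elem (f j), gen_b * e_elem (f j),
          e_elem (monic_recip (f j)), gen_b * e_elem (monic_recip (f j))]"
        using pair[OF *] by (intro local_basis_full_pair uf[OF jJ])
      moreover have "?S j = full_set_pair (f j)" using * j zeta by (simp add: basis_set_def)
      ultimately show ?thesis unfolding full_set_pair_rotated by blast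
    qed
  qed
  have local_ideal: "\<exists>xs. ?S j = rotated (degree (f j)) xs \<and> local_basis (f j) (\<alpha> j) (C j) xs"
    if j: "j \<in> J2 \<union> J3 \<union> J4" for j
  proof -
    have jJ: "j \<in> ?J" using j J_sub by blast
    have j1: "j \<notin> J1" using j J_disjoint by blast
    have disj: "j \<in> J2 \<Longrightarrow> j \<notin> J3 \<and> j \<notin> J4" "j \<in> J3 \<Longrightarrow> j \<notin> J4"
      using J_disjoint by blast+
    \<comment> \<open>The ideal is \<open>I\<^sub>j(p, q)\<close> in all three cases.\<close>
    define p q where "p = (if j \<in> J2 then 0 else if j \<in> J3 then 1 else - x j)"
      and "q = (if j \<in> J3 then 0 else 1 :: 'a alg_closure)"
    have pq_nonzero: "p \<noteq> 0 \<or> q \<noteq> 0" using disj by (auto simp: p_def q_def)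
    have C: "w \<in> C j \<longleftrightarrow> ?comp j w \<in> comp_ideal ?n r \<alpha> j p q" for w
      using j j1 disj by (auto simp: C_def B_def p_def q_def)
    show ?thesis
    proof (rule cases[OF jJ])
      fix c assume c: "c = 1 \<or> c = - 1" "\<alpha> j = to_ac c" "?comp j = (\<lambda>w. Inl (cyc_map c w))"
        "j \<le> zeta ?n" "degree (f j) = 1"
      define s' where "s' = (if j \<in> J3 then 1 else - 1 :: 'a alg_closure)"
      define y where "y = (if j \<in> J3 then e_elem (f j) + gen_b * e_elem (f j)
        else e_elem (f j) - gen_b * e_elem (f j) :: ('n, 'a) dihedral_algebra)"
      have "j \<notin> J4" using c(4) J_subset(4) by auto
      then have pq: "p + q = 1" "p - q = s'" using j disj by (auto simp: p_def q_def s'_def)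
      have "w \<in> C j \<longleftrightarrow> cyc_map c w \<in> {y * cyc_elem 1 s' | y. y \<in> cyc_algebra}" for w
        unfolding C comp_ideal_def using c(3,4) by (simp add: pq inj_image_mem_iff)
      moreover have "s' = 1 \<or> s' = - 1" by (simp add: s'_def)
      ultimately have "w \<in> C j \<longleftrightarrow> ref_at (\<alpha> j) w = s' * rot_at (\<alpha> j) w" for w
        unfolding c(2) using cyc_map_in_ideal_iff by blast
      moreover have "inverse (\<alpha> j) = \<alpha> j" using c(1,2) by auto
      ultimately have "local_basis (f j) (\<alpha> j) (C j) [y]"
        using c(5) by (intro local_basis_cyc[OF uf[OF jJ], where s = s']) (auto simp: y_def s'_def)
      moreover have "?S j = rotated (degree (f j)) [y]"
        using j j1 c(4,5) by (auto simp: basis_set_def rotated_Cons y_def)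
      ultimately show ?thesis by blast
    next
      assume *: "j \<in> {zeta ?n + 1..r}"
      let ?F = "adjoin (\<alpha> j + inverse (\<alpha> j))"
      have z: "\<alpha> j \<noteq> 0" "\<alpha> j \<noteq> inverse (\<alpha> j)" using root_nonzero[OF jJ] z_neq[of j] * by auto
      have uv: "ac_eval (u j) (\<alpha> j + inverse (\<alpha> j)) = p" "ac_eval (v j) (\<alpha> j + inverse (\<alpha> j)) = q"
        using uv_self[OF * j] j disj by (auto simp: p_def q_def split: if_splits)
      have "w \<in> C j \<longleftrightarrow> (\<exists>k\<in>?F. \<exists>t\<in>?F. sigma (\<alpha> j) (tau (\<alpha> j) w) = mat22 (k * q) (- k * p) (t * q) (- t * p))" for w
        unfolding C comp_ideal_def using * by (auto simp: comp_self comp_field_def)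
      then have "local_basis (f j) (\<alpha> j) (C j)
          [(1 + gen_b) * eval_at (F1 j) gen_a * eval_at (G1 j) gen_a
           * (gen_a * eval_at (u j) (gen_a + gen_a_inv) - eval_at (v j) (gen_a + gen_a_inv)) * e_elem (f j)]"
        using * jJ bezout_F[OF *] bezout_G[OF *] self[OF jJ] z
        by (intro local_basis_self[OF uf[OF jJ], where U = p and V = q and u = "u j" and v = "v j"])
          (use pq_nonzero in \<open>auto simp: uv sigma_tau_eq_iff algebra_simps\<close>)
      moreover have "?S j = ideal_set_self (f j) (F1 j) (G1 j) (u j) (v j)"
        using j j1 * by (auto simp: basis_set_def)
      ultimately show ?thesis unfolding ideal_set_self_rotated by blast
    next
      assume *: "j \<in> {r+1..r+s}"
      let ?F = "adjoin (\<alpha> j)"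
      \<comment> \<open>The generators for \<open>J3\<close> belong to \<open>I\<^sub>j(-1, 0)\<close>, which is the same ideal as \<open>I\<^sub>j(1, 0)\<close>.\<close>
      define \<epsilon> where "\<epsilon> = (if j \<in> J3 then - 1 else 1 :: 'a alg_closure)"
      have uv: "\<epsilon> * ac_eval (u j) (\<alpha> j) = q" "\<epsilon> * ac_eval (v j) (inverse (\<alpha> j)) = - p"
        using uv_pair_J2[OF *] uv_pair_J3[OF *] uv_pair_J4[OF *] j disj
        by (auto simp: p_def q_def \<epsilon>_def)
      have C_tau: "w \<in> C j \<longleftrightarrow> (\<exists>k\<in>?F. \<exists>t\<in>?F. tau (\<alpha> j) w = mat22 (k * q) (- k * p) (t * q) (- t * p))" for w
        unfolding C comp_ideal_def using * zeta by (auto simp: comp_pair comp_field_def)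
      define row_multiples where "row_multiples w k t \<longleftrightarrow>
          rot_at (\<alpha> j) w = k * ac_eval (u j) (\<alpha> j) \<and>
          ref_at (inverse (\<alpha> j)) w = k * ac_eval (v j) (inverse (\<alpha> j)) \<and>
          ref_at (\<alpha> j) w = t * ac_eval (u j) (\<alpha> j) \<and>
          rot_at (inverse (\<alpha> j)) w = t * ac_eval (v j) (inverse (\<alpha> j))"
        for w :: "('n, 'a) dihedral_algebra" and k t
      have "w \<in> C j \<longleftrightarrow> (\<exists>k\<in>?F. \<exists>t\<in>?F. row_multiples w k t)" for w
      proof -
        have \<epsilon>: "k * \<epsilon> \<in> ?F" "k * \<epsilon> * \<epsilon> = k" if "k \<in> ?F" for k
          using that adjoin_uminus[of k] by (auto simp: \<epsilon>_def)
        have tau: "tau (\<alpha> j) w = mat22 (k * q) (- k * p) (t * q) (- t * p)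
            \<longleftrightarrow> row_multiples w (k * \<epsilon>) (t * \<epsilon>)" for k t
          using uv by (auto simp: tau_altdef row_multiples_def mult.assoc)
        show ?thesis unfolding C_tau tau
        proof
          assume "\<exists>k\<in>?F. \<exists>t\<in>?F. row_multiples w (k * \<epsilon>) (t * \<epsilon>)"
          then show "\<exists>k\<in>?F. \<exists>t\<in>?F. row_multiples w k t" using \<epsilon>(1) by blast
        next
          assume "\<exists>k\<in>?F. \<exists>t\<in>?F. row_multiples w k t"
          then obtain k t where kt: "k \<in> ?F" "t \<in> ?F" "row_multiples w k t" by blast
          show "\<exists>k\<in>?F. \<exists>t\<in>?F. row_multiples w (k * \<epsilon>) (t * \<epsilon>)"
            by (rule bexI[OF _ \<epsilon>(1)[OF kt(1)]], rule bexI[OF _ \<epsilon>(1)[OF kt(2)]])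
              (simp add: \<epsilon>(2)[OF kt(1)] \<epsilon>(2)[OF kt(2)] kt(3))
        qed
      qed
      then have "local_basis (f j) (\<alpha> j) (C j)
          [eval_at (u j) gen_a * e_elem (f j) + gen_b * eval_at (v j) gen_a * e_elem (monic_recip (f j)),
           gen_b * (eval_at (u j) gen_a * e_elem (f j) + gen_b * eval_at (v j) gen_a * e_elem (monic_recip (f j)))]"
        using uv pq_nonzero
        by (intro local_basis_pair[OF uf[OF jJ] pair[OF *], where u = "u j" and v = "v j"])
          (auto simp: row_multiples_def)
      moreover have "?S j = ideal_set_pair (f j) (u j) (v j)"
        using j j1 * zeta by (auto simp: basis_set_def)
      ultimately show ?thesis unfolding ideal_set_pair_rotated by blast
    qed
  qed
  have "\<exists>xs. ?S j = rotated (degree (f j)) xs \<and> local_basis (f j) (\<alpha> j) (C j) xs" if "j \<in> ?J" for j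
    using local_zero[OF that] local_full[of j] local_ideal[of j] by blast
  then obtain xs where S: "\<And>j. j \<in> ?J \<Longrightarrow> ?S j = rotated (degree (f j)) (xs j)"
    and local: "\<And>j. j \<in> ?J \<Longrightarrow> local_basis (f j) (\<alpha> j) (C j) (xs j)"
    by metis
  have cong: "w' \<in> C j" if "j \<in> ?J" "agree_at (\<alpha> j) w w'" "w \<in> C j" for j w w'
    using that comp_eq_iff[of j w w'] by (simp add: C_def)
  note glued = glued_basis[OF _ code I_eq local cong unity_factor.degree_pos[OF uf] unity separate faithful]
  have T_eq: "T = (\<Union>j\<in>J1 \<union> J2 \<union> J3 \<union> J4. ?S j)"
  proof -
    have "?S j = {}" if "j \<notin> J1 \<union> J2 \<union> J3 \<union> J4" for j
      using that by (simp add: basis_set_def)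
    then show ?thesis unfolding T_def using J_sub by blast
  qed
  have "(\<Union>j\<in>?J. rotated (degree (f j)) (xs j)) = T"
    unfolding T_def using S by auto
  then have basis: "is_basis T I" using glued(1) by simp
  moreover have "?S j \<inter> ?S j' = {}" if "j \<in> ?J" "j' \<in> ?J" "j \<noteq> j'" for j j'
    unfolding S[OF that(1)] S[OF that(2)] by (rule glued(2)) (use that in auto)
  then have "is_generating_matrix (stack_rows (2 * ?n) (map M (sorted_list_of_set (J1 \<union> J2 \<union> J3 \<union> J4)))) I"
    if "\<forall>j\<in>J1 \<union> J2 \<union> J3 \<union> J4. is_rows_matrix_of_set (M j) (?S j)" for M
    using that basis[unfolded T_eq] J_sub finite_subset[OF J_sub]
    by (intro stacked_generating_matrix[where S = ?S]) (auto simp: subset_iff)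
  ultimately show ?thesis by blast
qed

end
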